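(* Let $d\ge3$ and let $\Omega\subset\mathbb{R}^d$ be a Lipschitz cluster with $N$ connected components $\omega_1,\dots,\omega_N$. For $i\in\{1,\dots,N\}$ let $\mathbf v_i,\mathbf w_i$ denote unit vectors in $\mathbb{R}^d$ and let $f_i,g_i$ be functions in $L^2(\omega_i)$. Further, let $\mathbf f$ and $\mathbf g$ be vector fields of the form $$\mathbf f=\sum_{i=1}^N\mathbf v_i f_i\,\chi_{\omega_i},\qquad \mathbf g=\sum_{i=1}^N\mathbf w_i g_i\,\chi_{\omega_i}.$$ If $\mathbf f$ and $\mathbf g$ generate the same magnetic potential, i.e. $P_{\Omega^c\leftarrow\Omega}(\mathbf f)=P_{\Omega^c\leftarrow\Omega}(\mathbf g)$, then on each $\omega_i$ it holds that $\langle f_i,1\rangle_{L^2(\omega_i)}=\langle g_i,1\rangle_{L^2(\omega_i)}$ and $$\text{either}\quad\langle f_i,1\rangle_{L^2(\omega_i)}=0\quad\text{or}\quad\mathbf v_i=\mathbf w_i.$$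
   Context: An open set is Lipschitz if its boundary is compact and, near each boundary point and after a rigid motion, the boundary is the graph of a Lipschitz function; consequently the connected components of a Lipschitz open set are finite in number and at positive distance from each other. A Lipschitz domain is a connected Lipschitz open set. A Lipschitz cluster is a Lipschitz open set that is a union of finitely many disjoint, bounded and simply connected Lipschitz domains. Functions in $L^2(\omega_i)$ are scalar (real) valued and $\langle f,1\rangle_{L^2(\omega_i)}=\int_{\omega_i}f(y)\,dy$. $\chi_A$ is the characteristic function of $A$ and $\Omega^c:=\mathbb{R}^d\setminus\overline\Omega$. With $N(x)=\frac{1}{(d-2)\omega_d}|x|^{2-d}$, where $\omega_d$ is the area of the unit sphere in $\mathbb{R}^d$, the magnetic potential of $\mathbf f\in L^2(\Omega;\mathbb{R}^d)$ is $P_{\Omega^c\leftarrow\Omega}(\mathbf f)(x)=\int_\Omega\nabla N(x-y)\cdot\mathbf f(y)\,dy$, $x\in\Omega^c$.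
   Formalization: The printed conclusion fails for v_i = b, f_i = 1, w_i = −b, g_i = −1 (identical fields); the formal conclusion adds, for each i, the alternative ⟨f_i,1⟩ = −⟨g_i,1⟩ with v_i = −w_i, and gives the printed claim whenever v_i ≠ −w_i. *)

theory Defs
  imports "HOL-Analysis.Analysis"
begin

(* Near each boundary point, after the rigid motion T, the set is the part strictly below the
   graph, in direction e, of a Lipschitz function phi on the hyperplane orthogonal to e.  The set
   lies on one side of its boundary only: this is what separates the components from each other. *)
definition lipschitz_open :: "'a::euclidean_space set \<Rightarrow> bool" where
  "lipschitz_open S \<longleftrightarrow>
     open S \<and> compact (frontier S) \<and>
     (\<forall>p\<in>frontier S. \<exists>U R a T e \<phi> L.
        open U \<and> p \<in> U \<and>
        orthogonal_transformation R \<and> T = (\<lambda>x. R x + a) \<and>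
        e \<in> Basis \<and> L-lipschitz_on {z. z \<bullet> e = 0} (\<phi> :: 'a \<Rightarrow> real) \<and>
        frontier S \<inter> U = {x\<in>U. T x \<bullet> e = \<phi> (T x - (T x \<bullet> e) *\<^sub>R e)} \<and>
        S \<inter> U = {x\<in>U. T x \<bullet> e < \<phi> (T x - (T x \<bullet> e) *\<^sub>R e)})"

definition lipschitz_domain :: "'a::euclidean_space set \<Rightarrow> bool" where
  "lipschitz_domain S \<longleftrightarrow> lipschitz_open S \<and> connected S"

definition lipschitz_cluster :: "'a::euclidean_space set \<Rightarrow> bool" where
  "lipschitz_cluster S \<longleftrightarrow>
     lipschitz_open S \<and>
     (\<exists>\<D>. finite \<D> \<and> disjoint \<D> \<and>
        (\<forall>D\<in>\<D>. bounded D \<and> simply_connected D \<and> lipschitz_domain D) \<and> S = \<Union>\<D>)"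

(* Elements of L^2 are represented by functions on the whole space; only the values on A matter. *)
definition L2_on :: "'a::euclidean_space set \<Rightarrow> ('a \<Rightarrow> real) set" where
  "L2_on A = {f \<in> borel_measurable (lebesgue_on A). integrable (lebesgue_on A) (\<lambda>x. (f x)\<^sup>2)}"

definition L2_inner :: "'a::euclidean_space set \<Rightarrow> ('a \<Rightarrow> real) \<Rightarrow> ('a \<Rightarrow> real) \<Rightarrow> real" where
  "L2_inner A f g = (\<integral>y. f y * g y \<partial>lebesgue_on A)"

definition gradient :: "('a::real_inner \<Rightarrow> real) \<Rightarrow> 'a \<Rightarrow> 'a" where
  "gradient f x = (THE D. GDERIV f x :> D)"

(* The area of the unit sphere is the dimension times the volume of the unit ball. *)
definition unit_sphere_area :: "'a::euclidean_space itself \<Rightarrow> real" where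
  "unit_sphere_area _ = real DIM('a) * measure lborel (ball (0::'a) 1)"

definition newton_kernel :: "'a::euclidean_space \<Rightarrow> real" where
  "newton_kernel x =
     1 / ((real DIM('a) - 2) * unit_sphere_area TYPE('a)) * norm x powi (2 - int DIM('a))"

definition magnetic_potential :: "'a::euclidean_space set \<Rightarrow> ('a \<Rightarrow> 'a) \<Rightarrow> 'a \<Rightarrow> real" where
  "magnetic_potential S F x = (\<integral>y. gradient newton_kernel (x - y) \<bullet> F y \<partial>lebesgue_on S)"

definition exterior :: "'a::topological_space set \<Rightarrow> 'a set" where
  "exterior S = - closure S"

end

theory Submission
  imports Defs
begin

text \<open>
  Let \<open>h = F - G\<close>. Its potential \<open>\<integral> (x - y) \<bullet> h y / |x - y|^d dy\<close> over \<open>\<Omega>\<close> vanishes for all \<open>x\<close> in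
  the exterior of \<open>\<Omega>\<close>. The claim is that this forces the integral of \<open>h\<close> over each component to
  vanish, that is, \<open>\<langle>f i, 1\<rangle> v i = \<langle>g i, 1\<rangle> w i\<close>; comparing norms of both sides then gives the alternatives.
  
  The argument is by duality. Every \<open>C^2\<close> function \<open>\<phi>\<close> of compact support is the convolution of the
  Newton kernel with \<open>- \<Delta>\<phi>\<close>, so \<open>\<nabla>\<phi> y\<close> is, up to a constant factor, the integral of
  \<open>(x - y) / |x - y|^d\<close> against \<open>\<Delta>\<phi> x\<close>. Pair this with \<open>h\<close> and exchange the two integrals: the integral of
  \<open>\<nabla>\<phi> \<bullet> h\<close> over \<open>\<Omega>\<close> equals the integral of \<open>\<Delta>\<phi>\<close> against the potential of \<open>h\<close>. If \<open>\<phi>\<close> is affine near each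
  component, then \<open>\<Delta>\<phi>\<close> lives in the exterior, where the potential vanishes, and the integral of
  \<open>\<nabla>\<phi> \<bullet> h\<close> is zero (\<open>integral_gradient_eq_0_of_vanishing_potential\<close>). For a fixed component and a vector \<open>a\<close>
  take \<open>\<phi> x = (a \<bullet> x) \<psi> x\<close>, where the cutoff \<open>\<psi>\<close> is \<open>1\<close> near that component and \<open>0\<close> near all others; then \<open>\<nabla>\<phi>\<close>
  is \<open>a\<close> on the one and \<open>0\<close> on the others, so the integral of \<open>h\<close> over the component is orthogonal to \<open>a\<close>.
  
  Such a cutoff (\<open>C2_cutoff\<close>) exists because distinct components have disjoint closures
  (\<open>lipschitz_open_components_closure_disjoint\<close>): near a boundary point the set lies on one side of a Lipschitz
  graph, hence is locally connected there.
  
  The representation of \<open>\<nabla>\<phi>\<close> by \<open>\<Delta>\<phi>\<close> enters in a regularised form. Replace \<open>|z|^2\<close> by \<open>\<epsilon>^2 + |z|^2\<close>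
  in the kernel, so that everything is smooth. Integration by parts then turns the kernel paired with \<open>\<Delta>\<phi>\<close> into an average of
  \<open>\<nabla>\<phi>\<close> against \<open>d \<epsilon>^2 (\<epsilon>^2 + |z|^2)^(-d/2 - 1)\<close> (\<open>reg_kernel_laplacian\<close>), and this weight has mass bounded away
  from zero on a small ball and is of order \<open>\<epsilon>^2\<close> outside it. As \<open>\<nabla>\<phi>\<close> is constant on small balls
  around the points of \<open>\<Omega>\<close>, letting \<open>\<epsilon>\<close> tend to \<open>0\<close> suffices, and since \<open>\<Delta>\<phi>\<close> lives at a positive
  distance from \<open>\<Omega>\<close>, the singularity of the limit kernel is never met.
\<close>

section \<open>Components of a Lipschitz open set\<close>

text \<open>
  The chart in a form free of the rigid motion: \<open>H\<close> is the height above the graph, \<open>n\<close> the direction that the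
  motion turns into the vertical. The two properties of \<open>H\<close> that make the set locally connected at \<open>p\<close> are that moving along \<open>n\<close> changes it
  at unit speed and that it grows at most linearly away from \<open>p\<close>.
\<close>
lemma lipschitz_chart_slide:
  fixes S :: "'a::euclidean_space set"
  assumes "lipschitz_open S" "p \<in> frontier S"
  obtains U n H K where "open U" "p \<in> U" "norm n = 1" "K \<ge> 0"
    "\<And>x s. H (x + s *\<^sub>R n) = H x + s" "\<And>x. \<bar>H x - H p\<bar> \<le> K * dist x p"
    "H p = (0::real)" "S \<inter> U = {x\<in>U. H x < 0}"
proof -
  obtain U R a T e \<phi> L where U: "open U" "p \<in> U" and R: "orthogonal_transformation R"
    and T: "T = (\<lambda>x. R x + a)" and e: "e \<in> Basis"
    and L: "L-lipschitz_on {z. z \<bullet> e = 0} (\<phi> :: 'a \<Rightarrow> real)"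
    and fr: "frontier S \<inter> U = {x\<in>U. T x \<bullet> e = \<phi> (T x - (T x \<bullet> e) *\<^sub>R e)}"
    and S: "S \<inter> U = {x\<in>U. T x \<bullet> e < \<phi> (T x - (T x \<bullet> e) *\<^sub>R e)}"
    using assms unfolding lipschitz_open_def by blast
  have ee: "e \<bullet> e = 1" using e by simp
  obtain n where n: "R n = e"
    using orthogonal_transformation_surj[OF R] by (metis surjD)
  have n1: "norm n = 1"
    using R n e by (metis norm_Basis orthogonal_transformation)
  have lin: "linear R" using R by (simp add: orthogonal_transformation_linear)
  define H where "H x = T x \<bullet> e - \<phi> (T x - (T x \<bullet> e) *\<^sub>R e)" for x
  have Te: "T (x + s *\<^sub>R n) = T x + s *\<^sub>R e" for x s
    using n by (simp add: T linear_add[OF lin] linear_scale[OF lin])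
  have slide: "H (x + s *\<^sub>R n) = H x + s" for x s
    by (simp add: H_def Te inner_left_distrib ee scaleR_left_distrib)
  have L0: "L \<ge> 0" using L by (simp add: lipschitz_on_def)
  have "\<bar>H x - H p\<bar> \<le> (1 + 2 * L) * dist x p" for x
  proof -
    have Txp: "norm (T x - T p) = dist x p"
      using R by (simp add: T dist_norm orthogonal_transformation linear_diff[OF lin, symmetric])
    let ?u = "T x - (T x \<bullet> e) *\<^sub>R e" and ?v = "T p - (T p \<bullet> e) *\<^sub>R e"
    have c: "\<bar>T x \<bullet> e - T p \<bullet> e\<bar> \<le> dist x p"
      using Cauchy_Schwarz_ineq2[of "T x - T p" e] e Txp by (simp add: inner_diff_left)
    have "?u - ?v = (T x - T p) - (T x \<bullet> e - T p \<bullet> e) *\<^sub>R e"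
      by (simp add: algebra_simps)
    then have "norm (?u - ?v) \<le> norm (T x - T p) + norm ((T x \<bullet> e - T p \<bullet> e) *\<^sub>R e)"
      using norm_triangle_ineq4 by metis
    then have uv: "dist ?u ?v \<le> 2 * dist x p"
      using c Txp e by (simp add: dist_norm)
    have "dist (\<phi> ?u) (\<phi> ?v) \<le> L * dist ?u ?v"
      by (rule lipschitz_onD[OF L]) (auto simp: inner_diff_left ee)
    also have "\<dots> \<le> L * (2 * dist x p)" using uv L0 by (rule mult_left_mono)
    finally have "\<bar>\<phi> ?u - \<phi> ?v\<bar> \<le> 2 * L * dist x p" by (simp add: dist_real_def)
    then show ?thesis using c unfolding H_def by (simp add: distrib_right)
  qed
  moreover have "p \<in> frontier S \<inter> U" using assms(2) U by blast
  then have "H p = 0" using fr by (simp add: H_def)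
  moreover have "S \<inter> U = {x\<in>U. H x < 0}" using S by (simp add: H_def)
  ultimately show ?thesis
    using that[OF U n1, of "1 + 2 * L" H] slide L0 by simp
qed

text \<open>
  Near a boundary point \<open>p\<close> the set is locally connected: from any of its points close to \<open>p\<close>, one can move straight down,
  away from the graph, into a ball that lies entirely below the graph. So only one component can accumulate at \<open>p\<close>.
\<close>
lemma lipschitz_open_components_closure_disjoint:
  fixes S :: "'a::euclidean_space set"
  assumes S: "lipschitz_open S" and C: "C \<in> components S" and D: "D \<in> components S"
    and "C \<noteq> D"
  shows "closure C \<inter> closure D = {}"
proof (rule ccontr)
  assume "closure C \<inter> closure D \<noteq> {}"
  then obtain p where p: "p \<in> closure C" "p \<in> closure D" by blast
  have op: "open S" using S by (simp add: lipschitz_open_def)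
  have meet: "\<exists>x\<in>A. x \<in> C" "\<exists>x\<in>A. x \<in> D" if "open A" "p \<in> A" for A
    using p that open_Int_closure_eq_empty[of A C] open_Int_closure_eq_empty[of A D] by blast+
  \<comment> \<open>It suffices to find a neighbourhood of the common point whose trace on the set
      lies in one component.\<close>
  have key: False if A: "open A" "p \<in> A" and E: "\<And>x. x \<in> A \<Longrightarrow> x \<in> S \<Longrightarrow> connected_component S q x" for A q
  proof -
    obtain x y where xy: "x \<in> A" "x \<in> C" "y \<in> A" "y \<in> D" using meet[OF A] by blast
    have "x \<in> S" "y \<in> S" using xy C D in_components_subset by blast+
    then have "connected_component S q x" "connected_component S q y" using E xy by auto
    then have "connected_component S x y"
      using connected_component_sym connected_component_trans by metis
    moreover have "C = connected_component_set S x" "D = connected_component_set S y"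
      using C D xy by (metis componentsE connected_component_eq)+
    ultimately show False using \<open>C \<noteq> D\<close> connected_component_eq by (metis mem_Collect_eq)
  qed
  show False
  proof (cases "p \<in> S")
    case True
    show False
      by (rule key[of "connected_component_set S p" p])
        (use True op in \<open>auto intro: open_connected_component connected_component_refl\<close>)
  next
    case False
    have "p \<in> closure S" using p(1) C by (meson closure_mono in_components_subset subsetD)
    then have "p \<in> frontier S" using False op by (simp add: frontier_def interior_open)
    then obtain U n and H :: "'a \<Rightarrow> real" and K where U: "open U" "p \<in> U" and n: "norm n = 1" and K: "K \<ge> 0"
      and slide: "\<And>x s. H (x + s *\<^sub>R n) = H x + s"
      and lip: "\<And>x. \<bar>H x - H p\<bar> \<le> K * dist x p"
      and Hp: "H p = 0" and SU: "S \<inter> U = {x\<in>U. H x < 0}"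
      by (rule lipschitz_chart_slide[OF S]) blast+
    obtain \<rho> where \<rho>: "\<rho> > 0" "ball p \<rho> \<subseteq> U" using U open_contains_ball by blast
    define t where "t = \<rho> / 2"
    define r where "r = t / (K + 1)"
    have t: "t > 0" using \<rho> by (simp add: t_def)
    have r: "r > 0" "K * r < t" "r \<le> t"
      using t K by (simp_all add: r_def field_simps)
    define q where "q = p - t *\<^sub>R n"
    have inS: "x \<in> S" if "dist x p < \<rho>" "H x < 0" for x
      using that \<rho> SU by (auto simp: dist_commute)
    have Hr: "H x \<le> K * r" if "x \<in> ball p r" for x
    proof -
      have "H x \<le> K * dist x p" using lip[of x] Hp by linarith
      also have "\<dots> \<le> K * r" using that K by (intro mult_left_mono) (auto simp: dist_commute)
      finally show ?thesis .
    qed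
    \<comment> \<open>The radius was chosen so small that the Lipschitz bound cannot undo the descent by \<open>t\<close>.\<close>
    have ball: "ball q r \<subseteq> S"
    proof
      fix z assume z: "z \<in> ball q r"
      have zn: "z + t *\<^sub>R n \<in> ball p r"
        using z by (simp add: q_def dist_norm algebra_simps)
      have "H z < 0" using Hr[OF zn] slide[of z t] r by linarith
      moreover have "dist z p \<le> dist z q + dist q p" by (rule dist_triangle)
      then have "dist z p < \<rho>" using z n t r by (simp add: q_def dist_norm dist_commute t_def norm_minus_commute)
      ultimately show "z \<in> S" by (rule inS[rotated])
    qed
    show False
    proof (rule key[of "ball p r" q])
      fix x assume x: "x \<in> ball p r" "x \<in> S"
      let ?y = "x - t *\<^sub>R n"
      have xU: "x \<in> U" using x r \<rho> t by (auto simp: t_def subset_iff)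
      have Hx: "H x < 0" using SU xU x by blast
      have "closed_segment x ?y \<subseteq> S"
      proof
        fix z assume "z \<in> closed_segment x ?y"
        then obtain u where u: "0 \<le> u" "u \<le> 1" "z = (1 - u) *\<^sub>R x + u *\<^sub>R ?y"
          by (auto simp: closed_segment_def)
        have z: "z = x + (- (u * t)) *\<^sub>R n" unfolding u(3) by (simp add: algebra_simps)
        have ut: "0 \<le> u * t" "u * t \<le> t" using u t by (auto simp: mult_left_le_one_le)
        have Hz: "H z < 0" using z slide[of x "-(u*t)"] Hx ut by simp
        have "dist z p \<le> dist z x + dist x p" by (rule dist_triangle)
        moreover have "dist z x = u * t" using ut n by (simp add: z dist_norm)
        moreover have "dist x p < r" using x by (simp add: dist_commute)
        moreover have "\<rho> = 2 * t" by (simp add: t_def)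
        ultimately have "dist z p < \<rho>" using ut r by linarith
        then show "z \<in> S" using Hz by (rule inS)
      qed
      then have "connected_component S x ?y"
        by (meson connected_component_def connected_segment ends_in_segment)
      moreover have "?y \<in> ball q r" using x by (simp add: q_def dist_norm)
      then have "connected_component S q ?y"
        using ball r by (meson centre_in_ball connected_ball connected_component_def)
      ultimately show "connected_component S q x"
        by (meson connected_component_sym connected_component_trans)
    qed (use r in auto)
  qed
qed

section \<open>Functions with continuous first and second derivatives\<close>

definition C1_grad :: "('a::euclidean_space \<Rightarrow> real) \<Rightarrow> ('a \<Rightarrow> 'a) \<Rightarrow> bool" where
  "C1_grad u D \<longleftrightarrow> continuous_on UNIV D \<and> (\<forall>x. GDERIV u x :> D x)"

text \<open>
  The gradient is carried as an argument, and the second derivatives appear as gradients of its components in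
  arbitrary directions, so that the closure properties below never mention a Hessian.
\<close>
definition C2_grad :: "('a::euclidean_space \<Rightarrow> real) \<Rightarrow> ('a \<Rightarrow> 'a) \<Rightarrow> bool" where
  "C2_grad u D \<longleftrightarrow> C1_grad u D \<and> (\<forall>b. \<exists>E. C1_grad (\<lambda>x. D x \<bullet> b) E)"

lemma C1_grad_continuous: "C1_grad u D \<Longrightarrow> continuous_on S u"
  unfolding C1_grad_def gderiv_def
  by (meson continuous_at_imp_continuous_on has_derivative_continuous)

text \<open>
  This determines the gradient of a test function wherever the function agrees with a simpler one, in particular outside
  its support and where a cutoff is constant.
\<close>
lemma C1_grad_unique_local:
  assumes "C1_grad u D" "open U" "x \<in> U" "\<And>y. y \<in> U \<Longrightarrow> u y = w y" "GDERIV w x :> d"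
  shows "D x = d"
proof -
  have "GDERIV u x :> d" 
    using assms(5) unfolding gderiv_def
    by (rule has_derivative_transform_within_open[OF _ assms(2,3)]) (simp add: assms(4))
  moreover have "GDERIV u x :> D x" using assms(1) by (simp add: C1_grad_def)
  ultimately have "(\<lambda>h. h \<bullet> D x) = (\<lambda>h. h \<bullet> d)"
    unfolding gderiv_def by (metis has_derivative_unique)
  then show ?thesis by (metis vector_eq_ldot)
qed

lemma C1_grad_const: "C1_grad (\<lambda>x. k) (\<lambda>x. 0)"
  by (simp add: C1_grad_def GDERIV_const)

lemma C1_grad_inner: "C1_grad (\<lambda>x. a \<bullet> x) (\<lambda>x. a)"
  by (auto simp: C1_grad_def gderiv_def inner_commute[of a] intro!: derivative_eq_intros)

lemma C1_grad_add: "C1_grad u D \<Longrightarrow> C1_grad w E \<Longrightarrow> C1_grad (\<lambda>x. u x + w x) (\<lambda>x. D x + E x)"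
  by (simp add: C1_grad_def GDERIV_add continuous_on_add)

lemma C1_grad_mult:
  "C1_grad u D \<Longrightarrow> C1_grad w E \<Longrightarrow> C1_grad (\<lambda>x. u x * w x) (\<lambda>x. u x *\<^sub>R E x + w x *\<^sub>R D x)"
  using C1_grad_continuous[of u D UNIV] C1_grad_continuous[of w E UNIV]
  by (auto simp: C1_grad_def intro!: GDERIV_mult continuous_intros)

lemma C1_grad_compose:
  assumes "C1_grad u D" "\<And>t. DERIV g t :> g' t" "continuous_on UNIV g'"
  shows "C1_grad (\<lambda>x. g (u x)) (\<lambda>x. g' (u x) *\<^sub>R D x)"
proof -
  have "continuous_on UNIV (\<lambda>x. g' (u x))"
    using continuous_on_compose2[OF assms(3) C1_grad_continuous[OF assms(1)]] by simp
  then show ?thesis using assms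
    by (auto simp: C1_grad_def intro: GDERIV_DERIV_compose intro!: continuous_on_scaleR)
qed

lemma C2_grad_const: "C2_grad (\<lambda>x. k) (\<lambda>x. 0)"
  unfolding C2_grad_def using C1_grad_const[of k] C1_grad_const[of 0] by auto

lemma C2_grad_inner: "C2_grad (\<lambda>x. a \<bullet> x) (\<lambda>x. a)"
  unfolding C2_grad_def using C1_grad_inner[of a] C1_grad_const by blast

lemma C2_grad_add: "C2_grad u D \<Longrightarrow> C2_grad w E \<Longrightarrow> C2_grad (\<lambda>x. u x + w x) (\<lambda>x. D x + E x)"
  unfolding C2_grad_def inner_add_left by (fast intro: C1_grad_add)

lemma C2_grad_mult:
  "C2_grad u D \<Longrightarrow> C2_grad w E \<Longrightarrow> C2_grad (\<lambda>x. u x * w x) (\<lambda>x. u x *\<^sub>R E x + w x *\<^sub>R D x)"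
  unfolding C2_grad_def inner_add_left inner_scaleR_left
  by (fast intro: C1_grad_mult C1_grad_add)

lemma C2_grad_compose:
  assumes "C2_grad u D" "\<And>t. DERIV g t :> g' t" "\<And>t. DERIV g' t :> g'' t" "continuous_on UNIV g''"
  shows "C2_grad (\<lambda>x. g (u x)) (\<lambda>x. g' (u x) *\<^sub>R D x)"
proof -
  have g': "continuous_on UNIV g'"
    using assms(3) by (meson DERIV_isCont continuous_at_imp_continuous_on)
  have u: "C1_grad u D" using assms(1) by (simp add: C2_grad_def)
  show ?thesis
    using assms(1) C1_grad_compose[OF u assms(2) g'] C1_grad_compose[OF u assms(3,4)]
    unfolding C2_grad_def inner_scaleR_left by (fast intro: C1_grad_mult)
qed

lemma C2_grad_sum:
  "finite I \<Longrightarrow> (\<And>i. i \<in> I \<Longrightarrow> \<exists>D. C2_grad (u i) D) \<Longrightarrow> \<exists>D. C2_grad (\<lambda>x. \<Sum>i\<in>I. u i x) D"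
proof (induction I rule: finite_induct)
  case empty show ?case using C2_grad_const[of 0] by auto
next
  case (insert i I)
  then obtain D E where "C2_grad (u i) D" "C2_grad (\<lambda>x. \<Sum>i\<in>I. u i x) E" by blast
  from C2_grad_add[OF this] show ?case using insert by auto
qed

section \<open>Cutoff functions\<close>

text \<open>
  Truncated powers serve as building blocks of bumps: the cube of the positive part is twice continuously differentiable.
\<close>
lemma DERIV_max_power:
  "DERIV (\<lambda>t::real. max 0 t ^ Suc (Suc n)) t :> real (Suc (Suc n)) * max 0 t ^ Suc n"
proof (cases t "0::real" rule: linorder_cases)
  case less
  have "DERIV (\<lambda>t::real. 0) t :> 0" by simp
  then have "DERIV (\<lambda>t::real. max 0 t ^ Suc (Suc n)) t :> 0"
    by (rule has_field_derivative_transform_within_open[of _ _ _ "{..<0}"]) (use less in auto)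
  then show ?thesis using less by simp
next
  case greater
  have "DERIV (\<lambda>t::real. t ^ Suc (Suc n)) t :> real (Suc (Suc n)) * t ^ Suc n"
    using DERIV_pow[of "Suc (Suc n)" t UNIV] by simp
  then have "DERIV (\<lambda>t::real. max 0 t ^ Suc (Suc n)) t :> real (Suc (Suc n)) * t ^ Suc n"
    by (rule has_field_derivative_transform_within_open[of _ _ _ "{0<..}"]) (use greater in auto)
  then show ?thesis using greater by simp
next
  case equal
  have "((\<lambda>h::real. max 0 h ^ Suc n) \<longlongrightarrow> max 0 0 ^ Suc n) (at 0)"
    by (intro tendsto_intros)
  then have "((\<lambda>h::real. max 0 h ^ Suc n) \<longlongrightarrow> 0) (at 0)" by simp
  then have "((\<lambda>h::real. (max 0 (0 + h) ^ Suc (Suc n) - max 0 0 ^ Suc (Suc n)) / h) \<longlongrightarrow> 0) (at 0)"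
    by (rule Lim_transform_eventually) (auto simp: eventually_at_filter max_def intro!: always_eventually)
  then show ?thesis using equal by (simp add: DERIV_def)
qed

text \<open>
  Cover \<open>A\<close> by finitely many small balls and add up the bumps \<open>(r^2 - |x - c|^2)^3\<close>, truncated at \<open>0\<close>. The
  sum \<open>\<eta>\<close> vanishes off the balls and, by compactness, is at least some \<open>m > 0\<close> on \<open>A\<close>. Composing with a \<open>C^2\<close> step that
  is \<open>0\<close> at \<open>0\<close> and \<open>1\<close> from \<open>m / 2\<close> on makes the function constant on a neighbourhood of \<open>A\<close>.
\<close>
lemma C2_cutoff:
  fixes A B :: "'a::euclidean_space set"
  assumes A: "compact A" and B: "closed B" and AB: "A \<inter> B = {}"
  obtains \<psi> D U V where "C2_grad \<psi> D" "open U" "A \<subseteq> U" "open V" "B \<subseteq> V"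
    "\<And>x. x \<in> U \<Longrightarrow> \<psi> x = 1" "\<And>x. x \<in> V \<Longrightarrow> \<psi> x = (0::real)" "bounded (- V)"
proof -
  obtain d where d: "d > 0" "\<And>x y. x \<in> A \<Longrightarrow> y \<in> B \<Longrightarrow> d \<le> dist x y"
    using separate_compact_closed[OF A B AB] by blast
  define r where "r = d / 2"
  have r: "r > 0" using d by (simp add: r_def)
  obtain F where F: "F \<subseteq> A" "finite F" "A \<subseteq> (\<Union>c\<in>F. ball c r)"
    using compactE_image[OF A, of A "\<lambda>c. ball c r"] r by (metis UN_I centre_in_ball open_ball subsetI)
  define \<eta> where "\<eta> x = (\<Sum>c\<in>F. max 0 (r\<^sup>2 - (dist x c)\<^sup>2) ^ 3)" for x
  define V where "V = - (\<Union>c\<in>F. cball c r)"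
  have "open V" unfolding V_def using F by (auto intro!: closed_UN)
  have "B \<subseteq> V"
    using d F by (force simp: V_def r_def)
  have bV: "bounded (- V)" using F by (auto simp: V_def intro!: bounded_UN)
  have \<eta>V: "\<eta> x = 0" if "x \<in> V" for x
  proof -
    have "max 0 (r\<^sup>2 - (dist x c)\<^sup>2) = 0" if "c \<in> F" for c
    proof -
      have "r \<le> dist x c" using that \<open>x \<in> V\<close> by (auto simp: V_def dist_commute)
      then show ?thesis using r by (simp add: max_def)
    qed
    then show ?thesis by (simp add: \<eta>_def)
  qed
  have \<eta>pos: "\<eta> x > 0" if "x \<in> A" for x
  proof -
    obtain c where c: "c \<in> F" "dist x c < r" using F \<open>x \<in> A\<close> by (auto simp: dist_commute)
    then have "(dist x c)\<^sup>2 < r\<^sup>2" by (simp add: power_strict_mono)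
    then have "0 < max 0 (r\<^sup>2 - (dist x c)\<^sup>2) ^ 3" by simp
    then show ?thesis unfolding \<eta>_def
      by (intro sum_pos2[OF F(2) c(1)]) auto
  qed
  have C2_bump: "\<exists>D. C2_grad (\<lambda>x. max 0 (r\<^sup>2 - (dist x c)\<^sup>2) ^ 3) D" for c :: 'a
  proof -
    have "\<exists>D. C2_grad (\<lambda>x. \<Sum>b\<in>Basis. (b \<bullet> x) * (b \<bullet> x)) D"
      by (rule C2_grad_sum) (auto intro: C2_grad_mult C2_grad_inner)
    then obtain D0 where "C2_grad (\<lambda>x::'a. \<Sum>b\<in>Basis. (b \<bullet> x) * (b \<bullet> x)) D0" ..
    from C2_grad_add[OF C2_grad_mult[OF C2_grad_const[of "-1"] this] C2_grad_add[OF C2_grad_inner[of "2 *\<^sub>R c"] C2_grad_const[of "r\<^sup>2 - c \<bullet> c"]]]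
    obtain D1 where D1: "C2_grad (\<lambda>x. -1 * (\<Sum>b\<in>Basis. (b \<bullet> x) * (b \<bullet> x)) + ((2 *\<^sub>R c) \<bullet> x + (r\<^sup>2 - c \<bullet> c))) D1" by blast
    have "(\<lambda>x. -1 * (\<Sum>b\<in>Basis. (b \<bullet> x) * (b \<bullet> x)) + ((2 *\<^sub>R c) \<bullet> x + (r\<^sup>2 - c \<bullet> c))) = (\<lambda>x. r\<^sup>2 - (dist x c)\<^sup>2)"
    proof
      fix x :: 'a
      have "(\<Sum>b\<in>Basis. (b \<bullet> x) * (b \<bullet> x)) = x \<bullet> x"
        by (simp add: euclidean_inner[of x x] inner_commute)
      then show "-1 * (\<Sum>b\<in>Basis. (b \<bullet> x) * (b \<bullet> x)) + ((2 *\<^sub>R c) \<bullet> x + (r\<^sup>2 - c \<bullet> c)) = r\<^sup>2 - (dist x c)\<^sup>2"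
        by (simp add: dist_norm power2_norm_eq_inner inner_diff_left inner_diff_right inner_commute)
    qed
    with D1 have D1: "C2_grad (\<lambda>x. r\<^sup>2 - (dist x c)\<^sup>2) D1" by simp
    have d1: "DERIV (\<lambda>t::real. max 0 t ^ 3) t :> 3 * max 0 t ^ 2" for t
      using DERIV_max_power[of 1 t] by (simp add: numeral_eq_Suc)
    have d2: "DERIV (\<lambda>t::real. 3 * max 0 t ^ 2) t :> 3 * (2 * max 0 t)" for t
      using DERIV_cmult[OF DERIV_max_power[of 0 t], of 3] by (simp add: numeral_eq_Suc)
    show ?thesis
      using C2_grad_compose[OF D1 d1 d2] by (force intro!: continuous_intros)
  qed
  obtain D\<eta> where D\<eta>: "C2_grad \<eta> D\<eta>"
    using C2_grad_sum[OF F(2), of "\<lambda>c x. max 0 (r\<^sup>2 - (dist x c)\<^sup>2) ^ 3"] C2_bump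
    unfolding \<eta>_def[abs_def] by blast
  have cont: "continuous_on S \<eta>" for S
    using D\<eta> C1_grad_continuous unfolding C2_grad_def by blast
  obtain m where m: "m > 0" "\<And>x. x \<in> A \<Longrightarrow> m \<le> \<eta> x"
  proof (cases "A = {}")
    case False
    then show ?thesis using continuous_attains_inf[OF A False cont] that \<eta>pos by blast
  qed (use that[of 1] in auto)
  define g where "g t = 1 - max 0 (1 - 2 / m * t) ^ 3" for t :: real
  define g' where "g' t = 6 / m * max 0 (1 - 2 / m * t) ^ 2" for t :: real
  define g'' where "g'' t = - (24 / m\<^sup>2) * max 0 (1 - 2 / m * t)" for t :: real
  have lin: "DERIV (\<lambda>t. 1 - 2 / m * t) t :> - (2 / m)" for t
    using m(1) by (auto intro!: derivative_eq_intros)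
  have dg: "DERIV g t :> g' t" for t
    using DERIV_diff[OF DERIV_const[of 1] DERIV_chain2[OF DERIV_max_power[of 1] lin[of t]]] m
    by (simp add: g_def[abs_def] g'_def numeral_eq_Suc field_simps)
  have dg': "DERIV g' t :> g'' t" for t
    using DERIV_cmult[OF DERIV_chain2[OF DERIV_max_power[of 0] lin[of t]], of "6 / m"] m
    by (simp add: g'_def[abs_def] g''_def numeral_eq_Suc field_simps)
  have cg: "continuous_on UNIV g''" unfolding g''_def[abs_def] by (intro continuous_intros)
  define U where "U = {x. m / 2 < \<eta> x}"
  have "open U" unfolding U_def by (rule open_Collect_less) (auto intro: cont)
  moreover have "A \<subseteq> U" using m by (force simp: U_def)
  moreover have "g (\<eta> x) = 1" if "x \<in> U" for x
    using that m by (simp add: U_def g_def max_def field_simps)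
  moreover have "g (\<eta> x) = 0" if "x \<in> V" for x using \<eta>V[OF that] by (simp add: g_def)
  ultimately show ?thesis
    using that[OF C2_grad_compose[OF D\<eta> dg dg' cg] _ _ \<open>open V\<close> \<open>B \<subseteq> V\<close>] bV by blast
qed

section \<open>Integration by parts\<close>

lemma integrable_continuous_bounded_support:
  fixes f :: "'a::euclidean_space \<Rightarrow> real"
  assumes "continuous_on UNIV f" "\<And>x. norm x > R \<Longrightarrow> f x = 0"
  shows "integrable lborel f"
proof -
  have "integrable lborel (\<lambda>x. indicator (cball 0 R) x *\<^sub>R f x)"
    by (rule borel_integrable_compact) (use assms(1) continuous_on_subset in auto)
  also have "(\<lambda>x. indicator (cball 0 R) x *\<^sub>R f x) = f"
    using assms(2) by (force simp: indicator_def)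
  finally show ?thesis .
qed

lemma bounded_continuous_bounded_support:
  fixes f :: "'a::euclidean_space \<Rightarrow> 'b::real_normed_vector"
  assumes "continuous_on UNIV f" "\<And>x. norm x > R \<Longrightarrow> f x = 0"
  obtains M where "M > 0" "\<And>x. norm (f x) \<le> M"
proof -
  have "compact (f ` cball 0 R)"
    using assms(1) by (intro compact_continuous_image) (auto intro: continuous_on_subset)
  then obtain M where M: "M > 0" "\<forall>x\<in>f ` cball 0 R. norm x \<le> M"
    using compact_imp_bounded bounded_pos by blast
  have "norm (f x) \<le> M" for x
    using M assms(2)[of x] by (cases "norm x > R") auto
  with M(1) show ?thesis by (rule that)
qed

lemma C1_grad_bounded_support:
  assumes "C1_grad u D" "\<And>x. norm x > R \<Longrightarrow> u x = 0" "norm x > R"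
  shows "D x = 0"
  by (rule C1_grad_unique_local[of u D "{x. norm x > R}" _ "\<lambda>x. 0"])
    (use assms in \<open>auto simp: GDERIV_const intro!: open_Collect_less continuous_intros\<close>)

lemma C1_grad_DERIV_line:
  assumes "C1_grad u D"
  shows "DERIV (\<lambda>t. u (x + t *\<^sub>R b)) t :> D (x + t *\<^sub>R b) \<bullet> b"
proof -
  have "((\<lambda>h. u h) has_derivative (\<lambda>h. h \<bullet> D (x + t *\<^sub>R b))) (at (x + t *\<^sub>R b))"
    using assms by (simp add: C1_grad_def gderiv_def)
  moreover have "((\<lambda>t. x + t *\<^sub>R b) has_derivative (\<lambda>h. h *\<^sub>R b)) (at t)"
    by (auto intro!: derivative_eq_intros)
  ultimately have "((\<lambda>t. u (x + t *\<^sub>R b)) has_derivative (\<lambda>h. (h *\<^sub>R b) \<bullet> D (x + t *\<^sub>R b))) (at t)"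
    by (rule has_derivative_compose[rotated])
  then show ?thesis
    by (simp add: has_field_derivative_def inner_commute mult.commute[of _ "_ \<bullet> _"])
qed

lemma integral_lborel_translate:
  fixes f :: "'a::euclidean_space \<Rightarrow> real"
  assumes [measurable]: "f \<in> borel_measurable borel"
  shows "(\<integral>x. f (c + x) \<partial>lborel) = (\<integral>x. f x \<partial>lborel)"
proof -
  have "(\<integral>x. f x \<partial>lborel) = (\<integral>x. f x \<partial>distr lborel borel ((+) c))"
    by (simp add: lborel_distr_plus)
  also have "\<dots> = (\<integral>x. f (c + x) \<partial>lborel)"
    by (rule integral_distr) auto
  finally show ?thesis by simp
qed

lemma integrable_lborel_translate:
  fixes f :: "'a::euclidean_space \<Rightarrow> real"
  assumes "integrable lborel f"
  shows "integrable lborel (\<lambda>x. f (c + x))"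
proof -
  have "integrable (distr lborel borel ((+) c)) f"
    using assms by (simp add: lborel_distr_plus)
  then show ?thesis by (subst (asm) integrable_distr_eq) (use assms in auto)
qed

text \<open>
  The integral of a difference quotient vanishes since Lebesgue measure is translation invariant; the mean value theorem
  bounds the quotients, so dominated convergence passes to the derivative.
\<close>
lemma integral_directional_derivative_eq_0:
  fixes u :: "'a::euclidean_space \<Rightarrow> real"
  assumes u: "C1_grad u D" and supp: "\<And>x. norm x > R \<Longrightarrow> u x = 0"
  shows "(\<integral>x. D x \<bullet> b \<partial>lborel) = 0"
proof -
  have cu: "continuous_on UNIV u" using C1_grad_continuous[OF u] .
  have cD: "continuous_on UNIV D" using u by (simp add: C1_grad_def)
  have iu: "integrable lborel u" by (rule integrable_continuous_bounded_support[OF cu supp])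
  have supD: "D x = 0" if "norm x > R" for x
    using C1_grad_bounded_support[OF u supp that] .
  obtain M where M: "M > 0" "\<And>x. norm (D x) \<le> M"
    using bounded_continuous_bounded_support[OF cD supD] by blast
  define q where "q n x = real (Suc n) * (u (inverse (real (Suc n)) *\<^sub>R b + x) - u x)" for n x
  have [measurable]: "u \<in> borel_measurable borel" "D \<in> borel_measurable borel"
    using cu cD by (auto intro: borel_measurable_continuous_onI)
  have q0: "(\<integral>x. q n x \<partial>lborel) = 0" for n
    using iu integrable_lborel_translate[OF iu] unfolding q_def
    by (simp add: Bochner_Integration.integral_diff integral_lborel_translate)
  have "(\<lambda>n. \<integral>x. q n x \<partial>lborel) \<longlonglongrightarrow> (\<integral>x. D x \<bullet> b \<partial>lborel)"
  proof (rule integral_dominated_convergence[where w = "\<lambda>x. indicator (cball 0 (R + norm b)) x * (M * norm b)"])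
    have "emeasure lborel (cball (0::'a) (R + norm b)) < \<infinity>"
      by (intro emeasure_bounded_finite bounded_cball)
    then show "integrable lborel (\<lambda>x::'a. indicator (cball 0 (R + norm b)) x * (M * norm b))"
      by (intro integrable_mult_left) simp
    show "AE x in lborel. (\<lambda>n. q n x) \<longlonglongrightarrow> D x \<bullet> b"
    proof (intro always_eventually allI)
      fix x
      have "((\<lambda>h. (u (x + h *\<^sub>R b) - u x) / h) \<longlongrightarrow> D x \<bullet> b) (at 0)"
        using C1_grad_DERIV_line[OF u, of x b 0] by (simp add: DERIV_def)
      moreover have "filterlim (\<lambda>n. inverse (real (Suc n))) (at 0) sequentially"
        using LIMSEQ_inverse_real_of_nat by (auto simp: filterlim_at)
      ultimately have "(\<lambda>n. (u (x + inverse (real (Suc n)) *\<^sub>R b) - u x) / inverse (real (Suc n))) \<longlonglongrightarrow> D x \<bullet> b"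
        by (rule filterlim_compose)
      then show "(\<lambda>n. q n x) \<longlonglongrightarrow> D x \<bullet> b"
        by (simp add: q_def add.commute divide_inverse mult.commute)
    qed
    fix n
    show "AE x in lborel. norm (q n x) \<le> indicator (cball 0 (R + norm b)) x * (M * norm b)"
    proof (intro always_eventually allI)
      fix x
      define h where "h = inverse (real (Suc n))"
      have h: "0 < h" "h \<le> 1" by (auto simp: h_def field_simps)
      have q: "q n x = (u (x + h *\<^sub>R b) - u x) / h"
        by (simp add: q_def h_def add.commute divide_inverse)
      show "norm (q n x) \<le> indicator (cball 0 (R + norm b)) x * (M * norm b)"
      proof (cases "norm x \<le> R + norm b")
        case True
        obtain t where t: "u (x + h *\<^sub>R b) - u (x + 0 *\<^sub>R b) = (h - 0) * (D (x + t *\<^sub>R b) \<bullet> b)"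
          using MVT2[OF h(1), of "\<lambda>t. u (x + t *\<^sub>R b)" "\<lambda>t. D (x + t *\<^sub>R b) \<bullet> b"]
            C1_grad_DERIV_line[OF u] by auto
        then have "q n x = D (x + t *\<^sub>R b) \<bullet> b" using h by (simp add: q)
        then have "norm (q n x) \<le> norm (D (x + t *\<^sub>R b)) * norm b"
          using Cauchy_Schwarz_ineq2 by simp
        also have "\<dots> \<le> M * norm b" using M by (intro mult_right_mono) auto
        finally show ?thesis using True by simp
      next
        case False
        have "norm (h *\<^sub>R b) \<le> norm b" using h by (simp add: mult_left_le_one_le)
        then have "norm (x + h *\<^sub>R b) > R"
          using False norm_triangle_ineq4[of "x + h *\<^sub>R b" "h *\<^sub>R b"] by simp
        moreover have "norm x > R" using False norm_ge_zero[of b] by linarith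
        ultimately show ?thesis using False by (simp add: q supp)
      qed
    qed
  qed (auto simp: q_def)
  then show ?thesis by (simp add: q0 LIMSEQ_const_iff)
qed

lemma integral_by_parts_directional:
  fixes u w :: "'a::euclidean_space \<Rightarrow> real"
  assumes u: "C1_grad u D" and w: "C1_grad w E" and supp: "\<And>x. norm x > R \<Longrightarrow> w x = 0"
  shows "(\<integral>x. u x * (E x \<bullet> b) \<partial>lborel) = - (\<integral>x. (D x \<bullet> b) * w x \<partial>lborel)"
proof -
  have cont: "continuous_on UNIV u" "continuous_on UNIV w" "continuous_on UNIV D" "continuous_on UNIV E"
    using u w C1_grad_continuous by (auto simp: C1_grad_def)
  have supE: "E x = 0" if "norm x > R" for x
    using C1_grad_bounded_support[OF w supp that] .
  have "0 = (\<integral>x. (u x *\<^sub>R E x + w x *\<^sub>R D x) \<bullet> b \<partial>lborel)"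
    by (rule integral_directional_derivative_eq_0[OF C1_grad_mult[OF u w], of R, symmetric])
      (simp add: supp)
  also have "\<dots> = (\<integral>x. u x * (E x \<bullet> b) + (D x \<bullet> b) * w x \<partial>lborel)"
    by (simp add: inner_add_left mult.commute)
  also have "\<dots> = (\<integral>x. u x * (E x \<bullet> b) \<partial>lborel) + (\<integral>x. (D x \<bullet> b) * w x \<partial>lborel)"
    by (intro Bochner_Integration.integral_add integrable_continuous_bounded_support[where R = R])
      (auto intro!: continuous_intros cont simp: supp supE)
  finally show ?thesis by simp
qed

section \<open>The regularised kernel\<close>

text \<open>
  For \<open>\<epsilon> = 0\<close> this is the power \<open>|z|^(2p)\<close>; the exponent is \<open>p = -d/2\<close> for the gradient of the Newton kernel.
\<close>
definition reg_power :: "real \<Rightarrow> real \<Rightarrow> 'a::euclidean_space \<Rightarrow> real" where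
  "reg_power \<epsilon> p z = (\<epsilon>\<^sup>2 + z \<bullet> z) powr p"

lemma C1_grad_reg_power:
  assumes "\<epsilon> > 0"
  shows "C1_grad (\<lambda>x. reg_power \<epsilon> p (x - y)) (\<lambda>x. (2 * p * reg_power \<epsilon> (p - 1) (x - y)) *\<^sub>R (x - y))"
proof -
  have pos: "\<epsilon>\<^sup>2 + z \<bullet> z > 0" for z :: 'a using assms by (simp add: add_pos_nonneg)
  have "continuous_on UNIV (\<lambda>x. (2 * p * reg_power \<epsilon> (p - 1) (x - y)) *\<^sub>R (x - y))"
    unfolding reg_power_def using pos by (intro continuous_intros) (metis less_irrefl)
  moreover have "GDERIV (\<lambda>x. reg_power \<epsilon> p (x - y)) x :> (2 * p * reg_power \<epsilon> (p - 1) (x - y)) *\<^sub>R (x - y)" for x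
  proof -
    have "GDERIV (\<lambda>x. \<epsilon>\<^sup>2 + (x - y) \<bullet> (x - y)) x :> 2 *\<^sub>R (x - y)"
      unfolding gderiv_def
      by (rule derivative_eq_intros refl)+ (auto simp: algebra_simps inner_commute)
    moreover have "DERIV (\<lambda>t. t powr p) (\<epsilon>\<^sup>2 + (x - y) \<bullet> (x - y)) :> p * (\<epsilon>\<^sup>2 + (x - y) \<bullet> (x - y)) powr (p - 1)"
      using pos[of "x - y"] by (rule has_real_derivative_powr)
    ultimately have "GDERIV (\<lambda>x. (\<epsilon>\<^sup>2 + (x - y) \<bullet> (x - y)) powr p) x :>
        (p * (\<epsilon>\<^sup>2 + (x - y) \<bullet> (x - y)) powr (p - 1)) *\<^sub>R (2 *\<^sub>R (x - y))"
      by (rule GDERIV_DERIV_compose)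
    then show ?thesis by (simp add: reg_power_def mult_ac)
  qed
  ultimately show ?thesis by (simp add: C1_grad_def)
qed

lemma C1_grad_inner_shift: "C1_grad (\<lambda>x. (x - y) \<bullet> c) (\<lambda>x. c)"
  by (auto simp: C1_grad_def gderiv_def intro!: derivative_eq_intros)

lemma reg_power_mult:
  assumes "\<epsilon> > 0"
  shows "(\<epsilon>\<^sup>2 + z \<bullet> z) * reg_power \<epsilon> (p - 1) z = reg_power \<epsilon> p z"
proof -
  have "\<epsilon>\<^sup>2 + z \<bullet> z > 0" using assms by (simp add: add_pos_nonneg)
  then show ?thesis by (simp add: reg_power_def powr_diff)
qed

text \<open>
  Write \<open>K q\<close> for \<open>reg_power \<epsilon> q\<close>. Both sides integrate by parts to the integral of \<open>\<phi>\<close> against the same function, because of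
  the pointwise identity \<open>\<Delta> ((z \<bullet> c) K p) = \<nabla> (d \<epsilon>^2 K (p - 1)) \<bullet> c\<close>. It holds for the
  exponent \<open>p = -d/2\<close> only: \<open>z K p\<close> is then a multiple of the gradient of the regularised Newton kernel, whose Laplacian is
  a multiple of \<open>\<epsilon>^2 K (p - 1)\<close>.
\<close>
lemma reg_kernel_laplacian:
  fixes y c :: "'a::euclidean_space"
  defines "p \<equiv> - (real DIM('a) / 2)"
  assumes \<epsilon>: "\<epsilon> > 0"
    and \<phi>: "C1_grad \<phi> D" and E: "\<And>b. C1_grad (\<lambda>x. D x \<bullet> b) (E b)"
    and supp: "\<And>x. norm x > R \<Longrightarrow> \<phi> x = 0"
  shows "(\<integral>x. ((x - y) \<bullet> c) * reg_power \<epsilon> p (x - y) * (\<Sum>b\<in>Basis. E b x \<bullet> b) \<partial>lborel)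
       = - (\<integral>x. (real DIM('a) * \<epsilon>\<^sup>2 * reg_power \<epsilon> (p - 1) (x - y)) * (D x \<bullet> c) \<partial>lborel)"
proof -
  let ?K = "\<lambda>p x. reg_power \<epsilon> p (x - y)"
  define m where "m x = ((x - y) \<bullet> c) * ?K p x" for x
  define n where "n b x = (x - y) \<bullet> c * (2 * p * ?K (p - 1) x * ((x - y) \<bullet> b)) + ?K p x * (c \<bullet> b)" for b x
  define m' where "m' x = ((x - y) \<bullet> c) *\<^sub>R (2 * p * ?K (p - 1) x) *\<^sub>R (x - y) + ?K p x *\<^sub>R c" for x
  have m: "C1_grad m m'"
    unfolding m_def[abs_def] m'_def[abs_def]
    by (rule C1_grad_mult[OF C1_grad_inner_shift C1_grad_reg_power[OF \<epsilon>]])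
  have m'n: "m' x \<bullet> b = n b x" for x b
    by (simp add: m'_def n_def inner_add_left)
  have "\<exists>N. C1_grad (n b) N \<and> (\<forall>x. N x \<bullet> b =
      2 * p * ?K (p - 1) x * (2 * (c \<bullet> b) * ((x - y) \<bullet> b) + ((x - y) \<bullet> c) * (b \<bullet> b))
      + 4 * p * (p - 1) * ?K (p - 2) x * ((x - y) \<bullet> c) * ((x - y) \<bullet> b)\<^sup>2)" for b
    unfolding n_def
    apply (rule exI, rule conjI)
     apply (rule C1_grad_add C1_grad_mult C1_grad_inner_shift C1_grad_reg_power[OF \<epsilon>] C1_grad_const)+
    apply (simp add: inner_add_left algebra_simps power2_eq_square)
    done
  then obtain N where N: "\<And>b. C1_grad (n b) (N b)"
    and Nb: "\<And>b x. N b x \<bullet> b =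
      2 * p * ?K (p - 1) x * (2 * (c \<bullet> b) * ((x - y) \<bullet> b) + ((x - y) \<bullet> c) * (b \<bullet> b))
      + 4 * p * (p - 1) * ?K (p - 2) x * ((x - y) \<bullet> c) * ((x - y) \<bullet> b)\<^sup>2"
    by metis
  define \<rho> where "\<rho> x = real DIM('a) * \<epsilon>\<^sup>2 * ?K (p - 1) x" for x
  define \<rho>' where "\<rho>' x = (real DIM('a) * \<epsilon>\<^sup>2) *\<^sub>R (2 * (p - 1) * ?K (p - 2) x) *\<^sub>R (x - y)" for x
  have \<rho>: "C1_grad \<rho> \<rho>'"
    using C1_grad_mult[OF C1_grad_const[of "real DIM('a) * \<epsilon>\<^sup>2"] C1_grad_reg_power[OF \<epsilon>, of "p - 1" y]]
    by (simp add: \<rho>_def[abs_def] \<rho>'_def[abs_def] diff_diff_eq)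
  \<comment> \<open>The pointwise identity between the Laplacian of the kernel and the derivative of the weight \<open>\<rho>\<close>.\<close>
  have lap: "(\<Sum>b\<in>Basis. N b x \<bullet> b) = \<rho>' x \<bullet> c" for x
  proof -
    let ?z = "x - y"
    have s1: "(\<Sum>b\<in>Basis. (c \<bullet> b) * (?z \<bullet> b)) = ?z \<bullet> c"
      by (simp add: euclidean_inner[of ?z c] mult.commute)
    have s2: "(\<Sum>b\<in>Basis. (?z \<bullet> b)\<^sup>2) = ?z \<bullet> ?z"
      by (simp add: euclidean_inner[of ?z ?z] power2_eq_square)
    have s3: "(\<Sum>b\<in>(Basis::'a set). b \<bullet> b) = real DIM('a)"
      by simp
    have sum_aux: "(\<Sum>b\<in>Basis. P * (2 * s b * t b + e * q b) + Q * w b) =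
        P * (2 * (\<Sum>b\<in>Basis. s b * t b) + e * (\<Sum>b\<in>Basis. q b)) + Q * (\<Sum>b\<in>Basis. w b)"
      for P Q e :: real and s t q w :: "'a \<Rightarrow> real"
      by (simp add: sum.distrib sum_distrib_left distrib_left mult.assoc)
    have "(\<Sum>b\<in>Basis. N b x \<bullet> b) =
        2 * p * ?K (p - 1) x * (2 * (\<Sum>b\<in>Basis. (c \<bullet> b) * (?z \<bullet> b)) + (?z \<bullet> c) * (\<Sum>b\<in>(Basis::'a set). b \<bullet> b))
        + 4 * p * (p - 1) * ?K (p - 2) x * (?z \<bullet> c) * (\<Sum>b\<in>Basis. (?z \<bullet> b)\<^sup>2)"
      unfolding Nb by (rule sum_aux)
    also have "\<dots> = 2 * p * (2 + real DIM('a)) * (?z \<bullet> c) * ?K (p - 1) x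
        + 4 * p * (p - 1) * ?K (p - 2) x * (?z \<bullet> c) * (?z \<bullet> ?z)"
      unfolding s1 s2 s3 by (simp add: algebra_simps)
    also have "?K (p - 1) x = (\<epsilon>\<^sup>2 + ?z \<bullet> ?z) * ?K (p - 2) x"
      using reg_power_mult[OF \<epsilon>, of ?z "p - 1"] by (simp add: diff_diff_eq)
    \<comment> \<open>With \<open>2 * p = - d\<close> the terms without the factor \<open>\<epsilon>^2\<close> cancel.\<close>
    also have "2 * p * (2 + real DIM('a)) * (?z \<bullet> c) * ((\<epsilon>\<^sup>2 + ?z \<bullet> ?z) * ?K (p - 2) x)
        + 4 * p * (p - 1) * ?K (p - 2) x * (?z \<bullet> c) * (?z \<bullet> ?z)
        = (real DIM('a) * \<epsilon>\<^sup>2) * (2 * (p - 1) * ?K (p - 2) x) * (?z \<bullet> c)"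
      unfolding p_def by (simp add: field_simps)
    also have "\<dots> = \<rho>' x \<bullet> c" by (simp add: \<rho>'_def)
    finally show ?thesis .
  qed
  have cont: "continuous_on UNIV m" "continuous_on UNIV \<phi>" "\<And>b. continuous_on UNIV (E b)"
      "\<And>b. continuous_on UNIV (N b)"
    using C1_grad_continuous[OF m] C1_grad_continuous[OF \<phi>] E N by (auto simp: C1_grad_def)
  have supD: "D x = 0" if "norm x > R" for x
    using C1_grad_bounded_support[OF \<phi> supp that] .
  have supE: "E b x = 0" if "norm x > R" for x b
    using C1_grad_bounded_support[OF E _ that, of b] supD by simp
  have "(\<integral>x. m x * (\<Sum>b\<in>Basis. E b x \<bullet> b) \<partial>lborel) = (\<Sum>b\<in>Basis. \<integral>x. m x * (E b x \<bullet> b) \<partial>lborel)"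
    unfolding sum_distrib_left
    by (intro Bochner_Integration.integral_sum integrable_continuous_bounded_support[where R = R])
      (auto intro!: continuous_intros cont simp: supE)
  also have "\<dots> = (\<Sum>b\<in>Basis. - (\<integral>x. n b x * (D x \<bullet> b) \<partial>lborel))"
    by (intro sum.cong refl, subst integral_by_parts_directional[OF m E, of R])
      (simp_all add: supD m'n)
  also have "\<dots> = (\<Sum>b\<in>Basis. \<integral>x. (N b x \<bullet> b) * \<phi> x \<partial>lborel)"
    by (intro sum.cong refl, subst integral_by_parts_directional[OF N \<phi> supp]) simp_all
  also have "\<dots> = (\<integral>x. (\<Sum>b\<in>Basis. (N b x \<bullet> b) * \<phi> x) \<partial>lborel)"
    by (intro Bochner_Integration.integral_sum[symmetric] integrable_continuous_bounded_support[where R = R])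
      (auto intro!: continuous_intros cont simp: supp)
  also have "\<dots> = (\<integral>x. (\<rho>' x \<bullet> c) * \<phi> x \<partial>lborel)"
    by (simp only: lap sum_distrib_right[symmetric])
  also have "\<dots> = - (\<integral>x. \<rho> x * (D x \<bullet> c) \<partial>lborel)"
    by (subst integral_by_parts_directional[OF \<rho> \<phi> supp]) simp_all
  finally show ?thesis by (simp add: m_def \<rho>_def)
qed

lemma reg_power_mono_neg:
  assumes "0 < \<delta>" "p \<le> 0" "\<delta>\<^sup>2 \<le> \<epsilon>\<^sup>2 + z \<bullet> z"
  shows "reg_power \<epsilon> p z \<le> \<delta>\<^sup>2 powr p"
  unfolding reg_power_def using assms by (intro powr_mono2') auto

lemma reg_power_measurable [measurable]: "reg_power \<epsilon> p \<in> borel_measurable borel"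
  unfolding reg_power_def[abs_def] by measurable

lemma continuous_reg_power: 
  assumes "\<epsilon> > 0"
  shows "continuous_on S (\<lambda>x. reg_power \<epsilon> p (x - y))"
  using C1_grad_continuous[OF C1_grad_reg_power[OF assms]] .

lemma integrable_reg_power_ball:
  fixes y :: "'a::euclidean_space"
  assumes "\<epsilon> > 0"
  shows "integrable lborel (\<lambda>x. indicator (ball y \<delta>) x * reg_power \<epsilon> p (x - y))"
proof -
  have "integrable lborel (\<lambda>x. indicator (cball y \<delta>) x *\<^sub>R reg_power \<epsilon> p (x - y))"
    by (rule borel_integrable_compact) (auto intro: continuous_reg_power assms)
  then have "integrable lborel (\<lambda>x. indicator (ball y \<delta>) x *\<^sub>R (indicator (cball y \<delta>) x *\<^sub>R reg_power \<epsilon> p (x - y)))"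
    by (rule integrable_mult_indicator[rotated]) auto
  moreover have "(\<lambda>x. indicator (ball y \<delta>) x *\<^sub>R (indicator (cball y \<delta>) x *\<^sub>R reg_power \<epsilon> p (x - y)))
      = (\<lambda>x. indicator (ball y \<delta>) x * reg_power \<epsilon> p (x - y))"
    by (auto simp: indicator_def)
  ultimately show ?thesis by simp
qed

section \<open>Averages against the regularised kernel\<close>

text \<open>
  The weight \<open>\<epsilon>^2 (\<epsilon>^2 + |z|^2)^p\<close> scales like an approximate identity, so its mass on the ball of radius
  \<open>\<epsilon>\<close> alone does not depend on \<open>\<epsilon>\<close>; there \<open>\<epsilon>^2 + |z|^2 \<le> 2 \<epsilon>^2\<close>. A lower bound for the mass is all that
  the passage to the limit requires.
\<close>
lemma reg_power_ball_mass_lower_bound: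
  defines "p \<equiv> - (real DIM('a) / 2) - 1"
  obtains k where "k > 0"
    "\<And>\<epsilon> \<delta>. 0 < \<epsilon> \<Longrightarrow> \<epsilon> \<le> \<delta> \<Longrightarrow>
      k \<le> \<epsilon>\<^sup>2 * (\<integral>z. indicator (ball (0::'a::euclidean_space) \<delta>) z * reg_power \<epsilon> p z \<partial>lborel)"
proof
  define V where "V = measure lborel (ball (0::'a) 1)"
  have "V > 0" unfolding V_def using content_ball_pos[of 1 "0::'a"] by simp
  then show "2 powr p * V > 0" by simp
  fix \<epsilon> \<delta> :: real assume \<epsilon>: "0 < \<epsilon>" "\<epsilon> \<le> \<delta>"
  have p0: "p \<le> 0" by (simp add: p_def)
  have "measure lborel (ball (0::'a) \<epsilon>) = \<epsilon> ^ DIM('a) * V"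
    using content_ball_conv_unit_ball[of \<epsilon> "0::'a"] \<epsilon> by (simp add: V_def)
  moreover have "(2 * \<epsilon>\<^sup>2) powr p = 2 powr p * (\<epsilon> ^ (DIM('a) + 2)) powr (-1)"
  proof -
    have "(\<epsilon>\<^sup>2) powr p = \<epsilon> powr (2 * p)" using \<epsilon> by (simp add: powr_powr flip: powr_numeral)
    also have "2 * p = - real (DIM('a) + 2)" by (simp add: p_def)
    also have "\<epsilon> powr (- real (DIM('a) + 2)) = (\<epsilon> ^ (DIM('a) + 2)) powr (-1)"
      using \<epsilon> powr_realpow[of \<epsilon> "DIM('a) + 2"] by (simp only: powr_minus powr_one) simp
    finally show ?thesis using \<epsilon> by (simp add: powr_mult)
  qed
  ultimately have eq: "2 powr p * V = \<epsilon>\<^sup>2 * (measure lborel (ball (0::'a) \<epsilon>) * (2 * \<epsilon>\<^sup>2) powr p)"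
    using \<epsilon> by (simp add: powr_minus power_add power2_eq_square field_simps)
  have "measure lborel (ball (0::'a) \<epsilon>) * (2 * \<epsilon>\<^sup>2) powr p
      = (\<integral>z. indicator (ball (0::'a) \<epsilon>) z * (2 * \<epsilon>\<^sup>2) powr p \<partial>lborel)"
    by simp
  also have "\<dots> \<le> (\<integral>z. indicator (ball (0::'a) \<delta>) z * reg_power \<epsilon> p z \<partial>lborel)"
  proof (rule integral_mono)
    show "integrable lborel (\<lambda>z. indicator (ball (0::'a) \<epsilon>) z * (2 * \<epsilon>\<^sup>2) powr p)"
      using emeasure_bounded_finite[OF bounded_ball, of "0::'a" \<epsilon>]
      by (intro integrable_mult_left) simp
    show "integrable lborel (\<lambda>z. indicator (ball (0::'a) \<delta>) z * reg_power \<epsilon> p z)"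
      using integrable_reg_power_ball[OF \<epsilon>(1), of 0 \<delta> p] by simp
    fix z :: 'a
    show "indicator (ball 0 \<epsilon>) z * (2 * \<epsilon>\<^sup>2) powr p \<le> indicator (ball 0 \<delta>) z * reg_power \<epsilon> p z"
    proof (cases "norm z < \<epsilon>")
      case True
      have "z \<bullet> z \<le> \<epsilon>\<^sup>2" using True by (simp add: power_mono flip: power2_norm_eq_inner)
      then have "(2 * \<epsilon>\<^sup>2) powr p \<le> reg_power \<epsilon> p z"
        unfolding reg_power_def using \<epsilon> p0 by (intro powr_mono2') (auto simp: add_pos_nonneg)
      then show ?thesis using True \<epsilon> by simp
    next
      case False
      then show ?thesis by (simp add: reg_power_def)
    qed
  qed
  finally show "2 powr p * V \<le> \<epsilon>\<^sup>2 * (\<integral>z. indicator (ball (0::'a) \<delta>) z * reg_power \<epsilon> p z \<partial>lborel)"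
    unfolding eq by (rule mult_left_mono) simp
qed

text \<open>
  On the ball around \<open>y\<close> the field is constant and contributes the mass of the weight times its value at \<open>y\<close>; outside the
  ball the weight is bounded uniformly in \<open>\<epsilon>\<close>. After multiplication by \<open>\<epsilon>^2\<close>, only the first part survives as
  \<open>\<epsilon>\<close> tends to \<open>0\<close>.
\<close>
lemma reg_power_average_near:
  fixes D :: "'a::euclidean_space \<Rightarrow> 'a"
  assumes \<epsilon>: "\<epsilon> > 0" and \<delta>: "\<delta> > 0" and p: "p \<le> 0"
    and D: "continuous_on UNIV D" and supp: "\<And>x. norm x > R \<Longrightarrow> D x = 0"
    and M: "\<And>x. norm (D x) \<le> M" and flat: "\<And>x. x \<in> ball y \<delta> \<Longrightarrow> D x = D y"
  shows "\<bar>(\<integral>x. reg_power \<epsilon> p (x - y) * (D x \<bullet> c) \<partial>lborel)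
      - (\<integral>z. indicator (ball (0::'a) \<delta>) z * reg_power \<epsilon> p z \<partial>lborel) * (D y \<bullet> c)\<bar>
    \<le> \<delta>\<^sup>2 powr p * M * measure lborel (cball (0::'a) R) * norm c"
proof -
  have M0: "M \<ge> 0" using M[of 0] norm_ge_zero order_trans by blast
  have [measurable]: "D \<in> borel_measurable borel"
    using D by (rule borel_measurable_continuous_onI)
  let ?K = "\<lambda>x. reg_power \<epsilon> p (x - y)" and ?I = "\<lambda>x. indicator (ball y \<delta>) x :: real"
  have near: "(\<integral>x. ?I x * ?K x \<partial>lborel) = (\<integral>z. indicator (ball (0::'a) \<delta>) z * reg_power \<epsilon> p z \<partial>lborel)"
    using integral_lborel_translate[of "\<lambda>x. ?I x * ?K x" y]
    by (simp add: indicator_def dist_norm mem_ball)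
  have int1: "integrable lborel (\<lambda>x. ?K x * (D x \<bullet> c))"
    by (rule integrable_continuous_bounded_support[where R = R])
      (auto intro!: continuous_intros continuous_reg_power \<epsilon> D simp: supp)
  have int2: "integrable lborel (\<lambda>x. (?I x * ?K x) * (D y \<bullet> c))"
    by (intro integrable_mult_left integrable_reg_power_ball \<epsilon>)
  have fin: "emeasure lborel (cball (0::'a) R) < \<infinity>"
    by (intro emeasure_bounded_finite bounded_cball)
  have "(\<integral>x. ?K x * (D x \<bullet> c) \<partial>lborel) - (\<integral>x. ?I x * ?K x \<partial>lborel) * (D y \<bullet> c)
      = (\<integral>x. ?K x * (D x \<bullet> c) - (?I x * ?K x) * (D y \<bullet> c) \<partial>lborel)"
    using int1 int2 by (simp add: Bochner_Integration.integral_diff)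
  also have "\<bar>\<dots>\<bar> \<le> (\<integral>x. indicator (cball (0::'a) R) x * (\<delta>\<^sup>2 powr p * M * norm c) \<partial>lborel)"
    unfolding real_norm_def[symmetric]
  proof (rule Bochner_Integration.integral_norm_bound_integral)
    show "integrable lborel (\<lambda>x. ?K x * (D x \<bullet> c) - (?I x * ?K x) * (D y \<bullet> c))"
      using int1 int2 by (rule Bochner_Integration.integrable_diff)
    show "integrable lborel (\<lambda>x. indicator (cball (0::'a) R) x * (\<delta>\<^sup>2 powr p * M * norm c))"
      using fin by (intro integrable_mult_left) simp
    fix x
    show "norm (?K x * (D x \<bullet> c) - (?I x * ?K x) * (D y \<bullet> c)) \<le> indicator (cball 0 R) x * (\<delta>\<^sup>2 powr p * M * norm c)"
    proof (cases "x \<in> ball y \<delta> \<or> norm x > R")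
      case True
      then show ?thesis using flat[of x] supp[of x] M0
        by (cases "x \<in> ball y \<delta>") auto
    next
      case False
      then have "\<delta> \<le> norm (x - y)" by (simp add: dist_norm norm_minus_commute)
      then have "\<delta>\<^sup>2 \<le> (x - y) \<bullet> (x - y)" using \<delta> by (simp add: power_mono flip: power2_norm_eq_inner)
      then have K: "?K x \<le> \<delta>\<^sup>2 powr p"
        by (intro reg_power_mono_neg \<delta> p) (meson le_add_same_cancel2 order_trans zero_le_power2)
      have "\<bar>D x \<bullet> c\<bar> \<le> norm (D x) * norm c" by (rule Cauchy_Schwarz_ineq2)
      also have "\<dots> \<le> M * norm c" using M by (rule mult_right_mono) simp
      finally have "?K x * \<bar>D x \<bullet> c\<bar> \<le> \<delta>\<^sup>2 powr p * (M * norm c)"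
        using K by (intro mult_mono) auto
      then show ?thesis using False by (simp add: abs_mult reg_power_def mult.assoc)
    qed
  qed
  also have "\<dots> = \<delta>\<^sup>2 powr p * M * measure lborel (cball (0::'a) R) * norm c"
    by simp
  finally show ?thesis unfolding near .
qed

section \<open>Duality between test functions and potentials\<close>

lemma reg_kernel_bound:
  assumes "0 < \<delta>" "p \<le> 0" "\<delta> \<le> norm z" "norm z \<le> B"
  shows "\<bar>(z \<bullet> c) * reg_power \<epsilon> p z\<bar> \<le> B * \<delta>\<^sup>2 powr p * norm c"
proof -
  have "\<delta>\<^sup>2 \<le> z \<bullet> z"
    using assms by (simp add: power_mono flip: power2_norm_eq_inner)
  then have r: "reg_power \<epsilon> p z \<le> \<delta>\<^sup>2 powr p"
    using assms by (intro reg_power_mono_neg) (auto intro: order_trans)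
  have "\<bar>z \<bullet> c\<bar> \<le> norm z * norm c" by (rule Cauchy_Schwarz_ineq2)
  also have "\<dots> \<le> B * norm c" using assms by (intro mult_right_mono) auto
  finally have "\<bar>z \<bullet> c\<bar> * reg_power \<epsilon> p z \<le> (B * norm c) * \<delta>\<^sup>2 powr p"
    using r by (intro mult_mono) (auto simp: reg_power_def intro: order_trans[OF abs_ge_zero])
  then show ?thesis by (simp add: abs_mult reg_power_def mult_ac)
qed

text \<open>
  Let \<open>L\<close> be the Laplacian of \<open>\<phi>\<close>, and integrate \<open>L x ((x - y) \<bullet> h y) (\<epsilon>^2 + |x - y|^2)^p\<close> over all pairs \<open>(x, y)\<close>; call the result
  \<open>J \<epsilon>\<close>. Since \<open>L x \<noteq> 0\<close> keeps \<open>x\<close> at distance \<open>\<delta>\<close> from \<open>\<Omega>\<close>, one integrable function dominates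
  all these integrands, and \<open>J \<epsilon>\<close> tends to \<open>J 0\<close>. Integrating first in \<open>y\<close> gives \<open>J 0 = 0\<close> by the vanishing of the potential.
  Integrating first in \<open>x\<close>, the preceding section gives \<open>J \<epsilon> = - d \<epsilon>^2 \<kappa> \<epsilon> I + O(\<epsilon>^2)\<close>, where \<open>I\<close> is the integral in
  question and \<open>\<epsilon>^2 \<kappa> \<epsilon>\<close> stays away from \<open>0\<close>. So \<open>I = 0\<close>.
\<close>
lemma integral_gradient_eq_0_of_vanishing_potential:
  fixes \<Omega> :: "'a::euclidean_space set" and h :: "'a \<Rightarrow> 'a"
  defines "p \<equiv> - (real DIM('a) / 2)"
  assumes \<Omega>: "bounded \<Omega>" "\<Omega> \<in> sets lebesgue"
    and h: "integrable (lebesgue_on \<Omega>) h"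
    and \<phi>: "C2_grad \<phi> D" and supp: "\<And>x. norm x > R \<Longrightarrow> \<phi> x = 0"
    and \<delta>: "\<delta> > 0" and flat: "\<And>x y. y \<in> \<Omega> \<Longrightarrow> x \<in> ball y \<delta> \<Longrightarrow> D x = D y"
    and potential: "\<And>x. (\<And>y. y \<in> \<Omega> \<Longrightarrow> \<delta> \<le> dist x y) \<Longrightarrow>
      (\<integral>y. ((x - y) \<bullet> h y) * reg_power 0 p (x - y) \<partial>lebesgue_on \<Omega>) = 0"
  shows "(\<integral>y. D y \<bullet> h y \<partial>lebesgue_on \<Omega>) = 0"
proof -
  have p0: "p \<le> 0" by (simp add: p_def)
  have \<phi>1: "C1_grad \<phi> D" using \<phi> by (simp add: C2_grad_def)
  obtain E where E: "\<And>b. C1_grad (\<lambda>x. D x \<bullet> b) (E b)"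
    using \<phi> unfolding C2_grad_def by metis
  define L where "L x = (\<Sum>b\<in>Basis. E b x \<bullet> b)" for x
  have contD: "continuous_on UNIV D" using \<phi>1 by (simp add: C1_grad_def)
  have contL: "continuous_on UNIV L"
    unfolding L_def[abs_def] using E by (intro continuous_intros) (simp add: C1_grad_def)
  have supD: "D x = 0" if "norm x > R" for x
    using C1_grad_bounded_support[OF \<phi>1 supp that] .
  have supL: "L x = 0" if "norm x > R" for x
  proof -
    have "E b x = 0" for b by (rule C1_grad_bounded_support[OF E _ that]) (simp add: supD)
    then show ?thesis by (simp add: L_def)
  qed
  have farL: "\<delta> \<le> dist x y" if "L x \<noteq> 0" "y \<in> \<Omega>" for x y
  proof (rule ccontr)
    assume "\<not> \<delta> \<le> dist x y"
    then have x: "x \<in> ball y \<delta>" by (simp add: dist_commute)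
    have "E b x = 0" for b
      by (rule C1_grad_unique_local[OF E _ x, of _ "\<lambda>_. D y \<bullet> b"])
        (use that flat in \<open>auto simp: GDERIV_const\<close>)
    then have "L x = 0" by (simp add: L_def)
    with that show False by simp
  qed
  obtain MD where MD: "MD > 0" "\<And>x. norm (D x) \<le> MD"
    using bounded_continuous_bounded_support[OF contD supD] by blast
  obtain B where B: "B > 0" "\<And>y. y \<in> \<Omega> \<Longrightarrow> norm y \<le> B"
    using \<Omega>(1) bounded_pos by blast
  have lm: "\<Omega> \<in> lmeasurable" using bounded_set_imp_lmeasurable \<Omega> by blast
  interpret F: finite_measure "lebesgue_on \<Omega>" using finite_measure_lebesgue_on[OF lm] .
  interpret P: pair_sigma_finite "lborel :: 'a measure" "lebesgue_on \<Omega>" ..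
  let ?M = "lborel \<Otimes>\<^sub>M lebesgue_on \<Omega>"
  have [measurable]: "(\<lambda>y. y) \<in> measurable (lebesgue_on \<Omega>) borel"
    by (intro measurable_restrict_space1) (simp add: measurable_completion)
  have [measurable]: "h \<in> borel_measurable (lebesgue_on \<Omega>)" using h by simp
  have [measurable]: "L \<in> borel_measurable borel" "D \<in> borel_measurable borel"
    using contL contD by (auto intro: borel_measurable_continuous_onI)
  define k where "k \<epsilon> = (\<lambda>(x, y). L x * (((x - y) \<bullet> h y) * reg_power \<epsilon> p (x - y)))" for \<epsilon>
  have k_meas [measurable]: "k \<epsilon> \<in> borel_measurable ?M" for \<epsilon>
    unfolding k_def by measurable
  define C where "C = (\<bar>R\<bar> + B) * \<delta>\<^sup>2 powr p"
  define w where "w = (\<lambda>(x, y). \<bar>L x\<bar> * (C * norm (h y)))"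
  have C0: "C \<ge> 0" using B by (simp add: C_def)
  have iw: "integrable ?M w"
  proof (rule P.Fubini_integrable)
    show "w \<in> borel_measurable ?M" unfolding w_def by measurable
    have iL: "integrable lborel (\<lambda>x. \<bar>L x\<bar>)"
      by (intro integrable_abs integrable_continuous_bounded_support[OF contL supL])
    show "integrable lborel (\<lambda>x. \<integral>y. norm (w (x, y)) \<partial>lebesgue_on \<Omega>)"
      using iL C0 by (simp add: w_def abs_mult)
    show "AE x in lborel. integrable (lebesgue_on \<Omega>) (\<lambda>y. w (x, y))"
      using h by (simp add: w_def)
  qed
  have kw: "norm (k \<epsilon> (x, y)) \<le> w (x, y)" if "y \<in> \<Omega>" for \<epsilon> x y
  proof (cases "L x = 0")
    case False
    have "norm x \<le> R" using supL False by force
    then have n: "norm (x - y) \<le> \<bar>R\<bar> + B"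
      using norm_triangle_ineq4[of x y] B(2)[OF that] by linarith
    have "\<delta> \<le> norm (x - y)" using farL[OF False that] by (simp add: dist_norm)
    then have "\<bar>((x - y) \<bullet> h y) * reg_power \<epsilon> p (x - y)\<bar> \<le> C * norm (h y)"
      unfolding C_def using n by (intro reg_kernel_bound \<delta> p0)
    then have "\<bar>L x\<bar> * \<bar>((x - y) \<bullet> h y) * reg_power \<epsilon> p (x - y)\<bar> \<le> \<bar>L x\<bar> * (C * norm (h y))"
      by (rule mult_left_mono) simp
    then show ?thesis by (simp add: k_def w_def abs_mult)
  qed (simp add: k_def w_def)
  have kw_AE: "AE z in ?M. norm (k \<epsilon> z) \<le> w z" for \<epsilon>
    using kw by (intro AE_I2) (auto simp: space_pair_measure)
  have ik: "integrable ?M (k \<epsilon>)" for \<epsilon>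
    by (rule Bochner_Integration.integrable_bound[OF iw k_meas])
      (use kw_AE[of \<epsilon>] in \<open>auto elim!: eventually_mono\<close>)
  define J where "J \<epsilon> = integral\<^sup>L ?M (k \<epsilon>)" for \<epsilon>
  define e where "e n = inverse (real (Suc n))" for n
  have e0: "e n > 0" for n by (simp add: e_def)
  have e_lim: "e \<longlonglongrightarrow> 0" unfolding e_def[abs_def] by (rule LIMSEQ_inverse_real_of_nat)
  \<comment> \<open>The limit kernel is singular on the diagonal only, and \<open>L x\<close> vanishes there.\<close>
  have "(\<lambda>n. J (e n)) \<longlonglongrightarrow> J 0"
    unfolding J_def
  proof (rule integral_dominated_convergence[OF _ _ iw])
    show "AE z in ?M. (\<lambda>n. k (e n) z) \<longlonglongrightarrow> k 0 z"
    proof (intro AE_I2, clarsimp simp: space_pair_measure)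
      fix x y assume y: "y \<in> \<Omega>"
      show "(\<lambda>n. k (e n) (x, y)) \<longlonglongrightarrow> k 0 (x, y)"
      proof (cases "L x = 0")
        case False
        then have "x \<noteq> y" using farL[OF False y] \<delta> by auto
        then have "(x - y) \<bullet> (x - y) \<noteq> 0" by simp
        then show ?thesis unfolding k_def reg_power_def
          by (auto intro!: tendsto_eq_intros e_lim)
      qed (simp add: k_def)
    qed
  qed (use kw_AE in auto)
  moreover have "J 0 = 0"
  proof -
    have "J 0 = (\<integral>x. (\<integral>y. k 0 (x, y) \<partial>lebesgue_on \<Omega>) \<partial>lborel)"
      unfolding J_def by (rule P.integral_fst'[OF ik, symmetric])
    also have "\<dots> = (\<integral>x. L x * (\<integral>y. ((x - y) \<bullet> h y) * reg_power 0 p (x - y) \<partial>lebesgue_on \<Omega>) \<partial>lborel)"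
      by (simp add: k_def)
    also have "\<dots> = (\<integral>x. 0 \<partial>(lborel :: 'a measure))"
      by (intro Bochner_Integration.integral_cong refl) (use potential farL in force)
    finally show ?thesis by simp
  qed
  ultimately have J_lim: "(\<lambda>n. J (e n)) \<longlonglongrightarrow> 0" by simp
  define I where "I = (\<integral>y. D y \<bullet> h y \<partial>lebesgue_on \<Omega>)"
  define \<kappa> where "\<kappa> \<epsilon> = (\<integral>z. indicator (ball (0::'a) \<delta>) z * reg_power \<epsilon> (p - 1) z \<partial>lborel)" for \<epsilon>
  define H where "H = \<delta>\<^sup>2 powr (p - 1) * MD * measure lborel (cball (0::'a) R) * (\<integral>y. norm (h y) \<partial>lebesgue_on \<Omega>)"
  have iDh: "integrable (lebesgue_on \<Omega>) (\<lambda>y. D y \<bullet> h y)"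
  proof (rule Bochner_Integration.integrable_bound)
    show "integrable (lebesgue_on \<Omega>) (\<lambda>y. MD * norm (h y))" using h by simp
    have "\<bar>D y \<bullet> h y\<bar> \<le> MD * norm (h y)" for y
      by (meson Cauchy_Schwarz_ineq2 MD(2) mult_right_mono norm_ge_zero order_trans)
    then show "AE y in lebesgue_on \<Omega>. norm (D y \<bullet> h y) \<le> norm (MD * norm (h y))"
      using MD(1) by (intro AE_I2) (simp add: abs_mult)
  qed measurable
  \<comment> \<open>The other order of integration, with an error that is small compared with the main term.\<close>
  have JI: "\<bar>J \<epsilon> + real DIM('a) * \<epsilon>\<^sup>2 * \<kappa> \<epsilon> * I\<bar> \<le> real DIM('a) * \<epsilon>\<^sup>2 * H" if \<epsilon>: "\<epsilon> > 0" for \<epsilon>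
  proof -
    define A where "A y = (\<integral>x. k \<epsilon> (x, y) \<partial>lborel)" for y
    have iA: "integrable (lebesgue_on \<Omega>) A"
      unfolding A_def[abs_def] using P.integrable_snd[of "\<lambda>x y. k \<epsilon> (x, y)"] ik by simp
    have JA: "J \<epsilon> = (\<integral>y. A y \<partial>lebesgue_on \<Omega>)"
      unfolding J_def A_def using P.integral_snd[of "\<lambda>x y. k \<epsilon> (x, y)"] ik by simp
    have A_eq: "A y = - (real DIM('a) * \<epsilon>\<^sup>2 * (\<integral>x. reg_power \<epsilon> (p - 1) (x - y) * (D x \<bullet> h y) \<partial>lborel))" for y
    proof -
      have "A y = (\<integral>x. ((x - y) \<bullet> h y) * reg_power \<epsilon> p (x - y) * (\<Sum>b\<in>Basis. E b x \<bullet> b) \<partial>lborel)"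
        by (simp add: A_def k_def L_def mult_ac)
      also have "\<dots> = - (\<integral>x. (real DIM('a) * \<epsilon>\<^sup>2 * reg_power \<epsilon> (p - 1) (x - y)) * (D x \<bullet> h y) \<partial>lborel)"
        unfolding p_def by (rule reg_kernel_laplacian[OF \<epsilon> \<phi>1 E supp])
      finally show ?thesis by (simp only: mult.assoc integral_mult_right_zero)
    qed
    have "J \<epsilon> + real DIM('a) * \<epsilon>\<^sup>2 * \<kappa> \<epsilon> * I = (\<integral>y. A y + real DIM('a) * \<epsilon>\<^sup>2 * \<kappa> \<epsilon> * (D y \<bullet> h y) \<partial>lebesgue_on \<Omega>)"
      unfolding JA I_def using iA iDh by simp
    also have "\<bar>\<dots>\<bar> \<le> (\<integral>y. real DIM('a) * \<epsilon>\<^sup>2 * (\<delta>\<^sup>2 powr (p - 1) * MD * measure lborel (cball (0::'a) R)) * norm (h y) \<partial>lebesgue_on \<Omega>)"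
      unfolding real_norm_def[symmetric]
    proof (rule Bochner_Integration.integral_norm_bound_integral)
      fix y assume "y \<in> space (lebesgue_on \<Omega>)"
      then have y: "y \<in> \<Omega>" by simp
      have "\<bar>(\<integral>x. reg_power \<epsilon> (p - 1) (x - y) * (D x \<bullet> h y) \<partial>lborel) - \<kappa> \<epsilon> * (D y \<bullet> h y)\<bar>
          \<le> \<delta>\<^sup>2 powr (p - 1) * MD * measure lborel (cball (0::'a) R) * norm (h y)" (is "\<bar>?S - ?T\<bar> \<le> ?B")
        unfolding \<kappa>_def
        by (rule reg_power_average_near[OF \<epsilon> \<delta> _ contD supD MD(2) flat[OF y]]) (use p0 in auto)
      then have "real DIM('a) * \<epsilon>\<^sup>2 * \<bar>?S - ?T\<bar> \<le> real DIM('a) * \<epsilon>\<^sup>2 * ?B"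
        by (rule mult_left_mono) simp
      moreover have "norm (A y + real DIM('a) * \<epsilon>\<^sup>2 * \<kappa> \<epsilon> * (D y \<bullet> h y)) = real DIM('a) * \<epsilon>\<^sup>2 * \<bar>?S - ?T\<bar>"
      proof -
        have "A y + real DIM('a) * \<epsilon>\<^sup>2 * \<kappa> \<epsilon> * (D y \<bullet> h y) = - (real DIM('a) * \<epsilon>\<^sup>2 * (?S - ?T))"
          by (simp add: A_eq algebra_simps)
        then show ?thesis by (simp add: abs_mult)
      qed
      ultimately show "norm (A y + real DIM('a) * \<epsilon>\<^sup>2 * \<kappa> \<epsilon> * (D y \<bullet> h y))
          \<le> real DIM('a) * \<epsilon>\<^sup>2 * (\<delta>\<^sup>2 powr (p - 1) * MD * measure lborel (cball (0::'a) R)) * norm (h y)"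
        by (simp only: mult.assoc)
    qed (use iA iDh h in auto)
    also have "\<dots> = real DIM('a) * \<epsilon>\<^sup>2 * H" by (simp add: H_def mult_ac)
    finally show ?thesis .
  qed
  obtain \<kappa>0 where \<kappa>0: "\<kappa>0 > 0" "\<And>\<epsilon>. 0 < \<epsilon> \<Longrightarrow> \<epsilon> \<le> \<delta> \<Longrightarrow> \<kappa>0 \<le> \<epsilon>\<^sup>2 * \<kappa> \<epsilon>"
    using reg_power_ball_mass_lower_bound[where ?'a = 'a] unfolding \<kappa>_def p_def by metis
  have "\<forall>\<^sub>F n in sequentially. e n < \<delta>" using order_tendstoD(2)[OF e_lim \<delta>] .
  then have "\<forall>\<^sub>F n in sequentially. real DIM('a) * \<kappa>0 * \<bar>I\<bar> \<le> \<bar>J (e n)\<bar> + real DIM('a) * (e n)\<^sup>2 * H"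
  proof eventually_elim
    case (elim n)
    have "\<kappa>0 \<le> (e n)\<^sup>2 * \<kappa> (e n)" using \<kappa>0(2)[OF e0] elim by simp
    then have "real DIM('a) * \<kappa>0 * \<bar>I\<bar> \<le> real DIM('a) * ((e n)\<^sup>2 * \<kappa> (e n)) * \<bar>I\<bar>"
      by (intro mult_right_mono mult_left_mono) auto
    also have "\<dots> = \<bar>real DIM('a) * (e n)\<^sup>2 * \<kappa> (e n) * I\<bar>"
      by (simp add: abs_mult \<kappa>_def reg_power_def mult.assoc)
    also have "\<dots> \<le> \<bar>J (e n)\<bar> + real DIM('a) * (e n)\<^sup>2 * H" using JI[OF e0[of n]] by linarith
    finally show ?case .
  qed
  moreover have "(\<lambda>n. \<bar>J (e n)\<bar> + real DIM('a) * (e n)\<^sup>2 * H) \<longlonglongrightarrow> 0"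
    by (auto intro!: tendsto_eq_intros J_lim e_lim)
  ultimately have "real DIM('a) * \<kappa>0 * \<bar>I\<bar> \<le> 0"
    by (intro tendsto_lowerbound[of _ 0 sequentially]) auto
  then have "\<bar>I\<bar> \<le> 0" using \<kappa>0(1) by (simp add: mult_le_0_iff)
  then show ?thesis by (simp add: I_def)
qed

section \<open>The magnetic potential\<close>

lemma newton_kernel_gradient:
  fixes z :: "'a::euclidean_space"
  assumes d: "DIM('a) \<ge> 3" and z: "z \<noteq> 0"
  shows "gradient newton_kernel z =
    (- (1 / unit_sphere_area TYPE('a)) * reg_power 0 (- (real DIM('a) / 2)) z) *\<^sub>R z"
proof -
  define c where "c = 1 / ((real DIM('a) - 2) * unit_sphere_area TYPE('a))"
  define n where "n = 2 - int DIM('a)"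
  have nz: "norm z > 0" using z by simp
  have "DERIV (\<lambda>t::real. c * t powi n) (norm z) :> c * (of_int n * norm z powi (n - 1))"
    using nz by (auto intro!: derivative_eq_intros)
  then have "GDERIV newton_kernel z :> (c * (of_int n * norm z powi (n - 1))) *\<^sub>R sgn z"
    unfolding newton_kernel_def c_def[symmetric] n_def[symmetric]
    using GDERIV_DERIV_compose[OF GDERIV_norm[OF z]] by blast
  moreover have "(c * (of_int n * norm z powi (n - 1))) *\<^sub>R sgn z
     = (- (1 / unit_sphere_area TYPE('a)) * reg_power 0 (- (real DIM('a) / 2)) z) *\<^sub>R z"
  proof -
    have "reg_power 0 (- (real DIM('a) / 2)) z = (norm z powr 2) powr (- (real DIM('a) / 2))"
      unfolding powr_numeral[OF norm_ge_zero] by (simp add: reg_power_def power2_norm_eq_inner)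
    also have "\<dots> = norm z powr (- real DIM('a))" by (simp only: powr_powr) simp
    also have "\<dots> = norm z powr real_of_int (n - 1) / norm z powr 1"
      unfolding powr_diff[symmetric] by (simp add: n_def)
    also have "\<dots> = norm z powi (n - 1) / norm z"
      using nz by (simp add: powr_real_of_int' del: of_int_diff)
    finally have r: "reg_power 0 (- (real DIM('a) / 2)) z = norm z powi (n - 1) / norm z" .
    have "c * of_int n = - (1 / unit_sphere_area TYPE('a))"
    proof -
      have n: "real_of_int n = - (real DIM('a) - 2)" and q: "real DIM('a) - 2 \<noteq> 0"
        using d by (simp_all add: n_def)
      have "1 / (q * u) * - q = - (1 / u)" if "q \<noteq> 0" for q u :: real
        using that by simp
      from this[OF q] show ?thesis unfolding c_def n .
    qed
    then have "c * (of_int n * norm z powi (n - 1)) = - (1 / unit_sphere_area TYPE('a)) * norm z powi (n - 1)"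
      by (simp only: mult.assoc[symmetric])
    then show ?thesis unfolding r sgn_div_norm by (simp add: divide_inverse mult.assoc)
  qed
  ultimately have g: "GDERIV newton_kernel z :>
     (- (1 / unit_sphere_area TYPE('a)) * reg_power 0 (- (real DIM('a) / 2)) z) *\<^sub>R z" by simp
  show ?thesis unfolding gradient_def
  proof (rule the_equality, rule g)
    fix D assume "GDERIV newton_kernel z :> D"
    then have "(\<lambda>h. h \<bullet> D) = (\<lambda>h. h \<bullet> ((- (1 / unit_sphere_area TYPE('a)) * reg_power 0 (- (real DIM('a) / 2)) z) *\<^sub>R z))"
      using g unfolding gderiv_def by (rule has_derivative_unique)
    then show "D = (- (1 / unit_sphere_area TYPE('a)) * reg_power 0 (- (real DIM('a) / 2)) z) *\<^sub>R z"
      by (metis vector_eq_ldot)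
  qed
qed

lemma unit_sphere_area_pos: "unit_sphere_area TYPE('a::euclidean_space) > 0"
  using content_ball_pos[of 1 "0::'a"] by (simp add: unit_sphere_area_def)

lemma magnetic_potential_reg_power:
  fixes x :: "'a::euclidean_space"
  assumes d: "DIM('a) \<ge> 3" and x: "x \<notin> S"
  shows "magnetic_potential S F x = - (1 / unit_sphere_area TYPE('a)) *
    (\<integral>y. ((x - y) \<bullet> F y) * reg_power 0 (- (real DIM('a) / 2)) (x - y) \<partial>lebesgue_on S)"
proof -
  have "magnetic_potential S F x = (\<integral>y. - (1 / unit_sphere_area TYPE('a)) *
      (((x - y) \<bullet> F y) * reg_power 0 (- (real DIM('a) / 2)) (x - y)) \<partial>lebesgue_on S)"
    unfolding magnetic_potential_def
  proof (rule Bochner_Integration.integral_cong[OF refl])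
    fix y assume "y \<in> space (lebesgue_on S)"
    then have "x - y \<noteq> 0" using x by auto
    then show "gradient newton_kernel (x - y) \<bullet> F y = - (1 / unit_sphere_area TYPE('a)) *
      (((x - y) \<bullet> F y) * reg_power 0 (- (real DIM('a) / 2)) (x - y))"
      by (simp add: newton_kernel_gradient[OF d])
  qed
  then show ?thesis by simp
qed

lemma integrable_reg_kernel:
  fixes h :: "'a::euclidean_space \<Rightarrow> 'a"
  assumes S: "bounded S" and h: "integrable (lebesgue_on S) h" and p: "p \<le> 0"
    and \<delta>: "\<delta> > 0" "\<And>y. y \<in> S \<Longrightarrow> \<delta> \<le> dist x y"
  shows "integrable (lebesgue_on S) (\<lambda>y. ((x - y) \<bullet> h y) * reg_power 0 p (x - y))"
proof -
  obtain B where B: "\<forall>y\<in>S. dist x y \<le> B"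
    using S bounded_any_center by metis
  have [measurable]: "(\<lambda>y. y) \<in> measurable (lebesgue_on S) borel"
    by (intro measurable_restrict_space1) (simp add: measurable_completion)
  have [measurable]: "h \<in> borel_measurable (lebesgue_on S)" using h by simp
  show ?thesis
  proof (rule Bochner_Integration.integrable_bound)
    show "integrable (lebesgue_on S) (\<lambda>y. B * \<delta>\<^sup>2 powr p * norm (h y))"
      using h by simp
    show "AE y in lebesgue_on S. norm (((x - y) \<bullet> h y) * reg_power 0 p (x - y)) \<le> norm (B * \<delta>\<^sup>2 powr p * norm (h y))"
    proof (intro AE_I2)
      fix y assume "y \<in> space (lebesgue_on S)"
      then have "\<delta> \<le> norm (x - y)" "norm (x - y) \<le> B" using B \<delta>(2) by (auto simp: dist_norm)
      from reg_kernel_bound[OF \<delta>(1) p this, of "h y" 0]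
      show "norm (((x - y) \<bullet> h y) * reg_power 0 p (x - y)) \<le> norm (B * \<delta>\<^sup>2 powr p * norm (h y))"
        by (metis abs_ge_self order_trans real_norm_def)
    qed
  qed measurable
qed

lemma L2_on_integrable:
  assumes "A \<in> lmeasurable" "f \<in> L2_on A"
  shows "integrable (lebesgue_on A) f"
proof -
  interpret finite_measure "lebesgue_on A" using finite_measure_lebesgue_on[OF assms(1)] .
  have f: "f \<in> borel_measurable (lebesgue_on A)" "integrable (lebesgue_on A) (\<lambda>x. (f x)\<^sup>2)"
    using assms(2) by (auto simp: L2_on_def)
  show ?thesis
  proof (rule Bochner_Integration.integrable_bound)
    show "integrable (lebesgue_on A) (\<lambda>x. 1 + (f x)\<^sup>2)" using f(2) by simp
    have "\<bar>t\<bar> \<le> 1 + t\<^sup>2" for t :: real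
    proof -
      have "0 \<le> (\<bar>t\<bar> - 1)\<^sup>2" by simp
      also have "(\<bar>t\<bar> - 1)\<^sup>2 = 1 + t\<^sup>2 - 2 * \<bar>t\<bar>" by (simp add: power2_eq_square algebra_simps)
      finally show ?thesis by linarith
    qed
    then show "AE x in lebesgue_on A. norm (f x) \<le> norm (1 + (f x)\<^sup>2)"
      by (intro AE_I2) (simp add: add_nonneg_nonneg)
  qed (rule f(1))
qed

section \<open>Uniqueness of the mean moments\<close>

text \<open>
  Comparing norms gives \<open>|\<alpha>| = |\<beta>|\<close>. Flipping the sign of both the scalar and the unit vector leaves the product
  unchanged, which is where the second alternative comes from.
\<close>
lemma unit_vector_scaled_eq_cases:
  fixes v w :: "'a::real_normed_vector"
  assumes "norm v = 1" "norm w = 1" "\<alpha> *\<^sub>R v = \<beta> *\<^sub>R w"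
  shows "(\<alpha> = \<beta> \<and> (\<alpha> = 0 \<or> v = w)) \<or> (\<alpha> = - \<beta> \<and> v = - w)"
proof -
  have "\<bar>\<alpha>\<bar> = \<bar>\<beta>\<bar>" using assms by (metis mult.right_neutral norm_scaleR)
  then consider "\<alpha> = \<beta>" | "\<alpha> = - \<beta>" "\<beta> \<noteq> 0" by (auto simp: abs_if split: if_splits)
  then show ?thesis
  proof cases
    case 1
    then show ?thesis using assms(3) by auto
  next
    case 2
    then have "\<beta> *\<^sub>R (- v) = \<beta> *\<^sub>R w" using assms(3) by simp
    then have "- v = w" using 2 by (simp only: scaleR_cancel_left) simp
    then show ?thesis using 2 by auto
  qed
qed

theorem corollary3p7:
  fixes \<Omega> :: "'a::euclidean_space set"
    and N :: nat
    and \<omega> :: "nat \<Rightarrow> 'a set"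
    and v w :: "nat \<Rightarrow> 'a"
    and f g :: "nat \<Rightarrow> 'a \<Rightarrow> real"
    and F G :: "'a \<Rightarrow> 'a"
  assumes "DIM('a) \<ge> 3"
    and "lipschitz_cluster \<Omega>"
    and "bij_betw \<omega> {1..N} (components \<Omega>)"
    and "\<And>i. i \<in> {1..N} \<Longrightarrow> norm (v i) = 1"
    and "\<And>i. i \<in> {1..N} \<Longrightarrow> norm (w i) = 1"
    and "\<And>i. i \<in> {1..N} \<Longrightarrow> f i \<in> L2_on (\<omega> i)"
    and "\<And>i. i \<in> {1..N} \<Longrightarrow> g i \<in> L2_on (\<omega> i)"
    and "F = (\<lambda>x. \<Sum>i=1..N. (f i x * indicator (\<omega> i) x) *\<^sub>R v i)"
    and "G = (\<lambda>x. \<Sum>i=1..N. (g i x * indicator (\<omega> i) x) *\<^sub>R w i)"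
    and "\<And>x. x \<in> exterior \<Omega> \<Longrightarrow> magnetic_potential \<Omega> F x = magnetic_potential \<Omega> G x"
  shows "\<forall>i\<in>{1..N}.
      (L2_inner (\<omega> i) (f i) (\<lambda>_. 1) = L2_inner (\<omega> i) (g i) (\<lambda>_. 1) \<and>
        (L2_inner (\<omega> i) (f i) (\<lambda>_. 1) = 0 \<or> v i = w i)) \<or>
      (L2_inner (\<omega> i) (f i) (\<lambda>_. 1) = - L2_inner (\<omega> i) (g i) (\<lambda>_. 1) \<and> v i = - w i)"
proof
  fix i assume i: "i \<in> {1..N}"
  let ?p = "- (real DIM('a) / 2)"
  have lip: "lipschitz_open \<Omega>" using assms(2) by (simp add: lipschitz_cluster_def)
  then have op: "open \<Omega>" by (simp add: lipschitz_open_def)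
  have bd: "bounded \<Omega>" using assms(2) unfolding lipschitz_cluster_def by (auto intro: bounded_Union)
  have comp: "\<omega> j \<in> components \<Omega>" if "j \<in> {1..N}" for j
    using assms(3) that by (meson bij_betwE)
  have sub: "\<omega> j \<subseteq> \<Omega>" if "j \<in> {1..N}" for j
    using in_components_subset[OF comp[OF that]] .
  have union: "\<Omega> = (\<Union>j\<in>{1..N}. \<omega> j)"
    using assms(3) Union_components[of \<Omega>] by (simp add: bij_betw_def)
  have inj: "\<omega> j \<noteq> \<omega> k" if "j \<in> {1..N}" "k \<in> {1..N}" "j \<noteq> k" for j k
    using bij_betw_imp_inj_on[OF assms(3)] that by (metis inj_onD)
  have sep: "closure (\<omega> j) \<inter> closure (\<omega> k) = {}" if "j \<in> {1..N}" "k \<in> {1..N}" "j \<noteq> k" for j k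
    by (rule lipschitz_open_components_closure_disjoint[OF lip comp comp inj]) (use that in simp_all)
  have dis: "y \<notin> \<omega> k" if "y \<in> \<omega> j" "j \<in> {1..N}" "k \<in> {1..N}" "j \<noteq> k" for j k y
    using sep[OF that(2-4)] that(1) closure_subset by blast
  have lm: "\<omega> j \<in> lmeasurable" if "j \<in> {1..N}" for j
    using op comp[OF that] sub[OF that] bd
    by (intro lmeasurable_open) (auto intro: open_components bounded_subset)
  have lm\<Omega>: "\<Omega> \<in> lmeasurable" using op bd by (rule lmeasurable_open[rotated])
  have setsL: "\<omega> j \<inter> space lebesgue \<in> sets lebesgue" if "j \<in> {1..N}" for j
    using lm[OF that] by (simp add: fmeasurableD)
  have sets\<Omega>: "\<Omega> \<inter> space lebesgue \<in> sets lebesgue" using lm\<Omega> by (simp add: fmeasurableD)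
  have int1: "integrable lebesgue (\<lambda>x. indicator (\<omega> j) x *\<^sub>R q x)"
    if "j \<in> {1..N}" "q \<in> L2_on (\<omega> j)" for j q
    using L2_on_integrable[OF lm[OF that(1)] that(2)] integrable_restrict_space[OF setsL[OF that(1)]] by blast
  have int2: "integrable (lebesgue_on \<Omega>) (\<lambda>x. \<Sum>i=1..N. (q i x * indicator (\<omega> i) x) *\<^sub>R u i)"
    if "\<And>j. j \<in> {1..N} \<Longrightarrow> q j \<in> L2_on (\<omega> j)" for q and u :: "nat \<Rightarrow> 'a"
  proof -
    have "integrable lebesgue (\<lambda>x. \<Sum>i=1..N. (q i x * indicator (\<omega> i) x) *\<^sub>R u i)"
      using int1[OF _ that] by (intro Bochner_Integration.integrable_sum integrable_scaleR_left) (simp add: mult.commute)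
    then show ?thesis
      unfolding integrable_restrict_space[OF sets\<Omega>]
      using lm\<Omega> by (intro integrable_mult_indicator) auto
  qed
  have iF: "integrable (lebesgue_on \<Omega>) F" unfolding assms(8) by (rule int2[OF assms(6)])
  have iG: "integrable (lebesgue_on \<Omega>) G" unfolding assms(9) by (rule int2[OF assms(7)])
  have val: "(\<Sum>k=1..N. (q k y * indicator (\<omega> k) y) *\<^sub>R u k) = q j y *\<^sub>R u j"
    if "y \<in> \<omega> j" "j \<in> {1..N}" for y j q and u :: "nat \<Rightarrow> 'a"
  proof -
    have "(\<Sum>k=1..N. (q k y * indicator (\<omega> k) y) *\<^sub>R u k) = (\<Sum>k=1..N. if k = j then q j y *\<^sub>R u j else 0)"
      using that dis[OF that] by (intro sum.cong) (auto simp: indicator_def)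
    then show ?thesis using that by simp
  qed
  define \<alpha> where "\<alpha> = L2_inner (\<omega> i) (f i) (\<lambda>_. 1)"
  define \<beta> where "\<beta> = L2_inner (\<omega> i) (g i) (\<lambda>_. 1)"
  \<comment> \<open>Test with \<open>\<phi> x = (a \<bullet> x) \<psi> x\<close>, where \<open>\<psi>\<close> separates the closure \<open>A\<close> of the component from
      the union \<open>B\<close> of the closures of the others.\<close>
  have "a \<bullet> (\<alpha> *\<^sub>R v i - \<beta> *\<^sub>R w i) = 0" for a :: 'a
  proof -
    define A where "A = closure (\<omega> i)"
    define B where "B = (\<Union>j\<in>{1..N} - {i}. closure (\<omega> j))"
    have A: "compact A" using bd sub[OF i] by (simp add: A_def bounded_subset)
    have clB: "compact B" unfolding B_def
      using bd sub by (intro compact_UN) (auto intro: bounded_subset)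
    have AB: "A \<inter> B = {}" using sep[OF i] unfolding A_def B_def by blast
    obtain \<psi> D\<psi> U V where \<psi>: "C2_grad \<psi> D\<psi>" and U: "open U" "A \<subseteq> U" and V: "open V" "B \<subseteq> V"
      and \<psi>U: "\<And>x. x \<in> U \<Longrightarrow> \<psi> x = 1" and \<psi>V: "\<And>x. x \<in> V \<Longrightarrow> \<psi> x = (0::real)" and bV: "bounded (- V)"
      by (rule C2_cutoff[OF A compact_imp_closed[OF clB] AB]) blast
    obtain \<delta>1 where \<delta>1: "\<delta>1 > 0" "(\<Union>x\<in>A. ball x \<delta>1) \<subseteq> U"
      using compact_subset_open_imp_ball_epsilon_subset[OF A U] by blast
    obtain \<delta>2 where \<delta>2: "\<delta>2 > 0" "(\<Union>x\<in>B. ball x \<delta>2) \<subseteq> V"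
      using compact_subset_open_imp_ball_epsilon_subset[OF clB V] by blast
    define \<delta> where "\<delta> = min \<delta>1 \<delta>2"
    have \<delta>: "\<delta> > 0" using \<delta>1 \<delta>2 by (simp add: \<delta>_def)
    have ballU: "ball y \<delta> \<subseteq> U" if "y \<in> \<omega> i" for y
    proof -
      have "ball y \<delta>1 \<subseteq> U" using that \<delta>1(2) closure_subset unfolding A_def by blast
      then show ?thesis by (auto simp: \<delta>_def)
    qed
    have ballV: "ball y \<delta> \<subseteq> V" if "y \<in> \<omega> j" "j \<in> {1..N}" "j \<noteq> i" for y j
    proof -
      have "y \<in> B" using that closure_subset unfolding B_def by blast
      then have "ball y \<delta>2 \<subseteq> V" using \<delta>2(2) by blast
      then show ?thesis by (auto simp: \<delta>_def)
    qed
    obtain R where R: "\<And>x. norm x > R \<Longrightarrow> x \<in> V"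
      using bV unfolding bounded_iff by (meson ComplI not_le)
    define \<phi> where "\<phi> x = (a \<bullet> x) * \<psi> x" for x
    define D where "D x = (a \<bullet> x) *\<^sub>R D\<psi> x + \<psi> x *\<^sub>R a" for x
    have \<phi>: "C2_grad \<phi> D"
      unfolding \<phi>_def[abs_def] D_def[abs_def] by (rule C2_grad_mult[OF C2_grad_inner \<psi>])
    then have \<phi>1: "C1_grad \<phi> D" by (simp add: C2_grad_def)
    have DU: "D x = a" if "x \<in> U" for x
      by (rule C1_grad_unique_local[OF \<phi>1 U(1) that, of "\<lambda>x. a \<bullet> x"])
        (use C1_grad_inner[of a] in \<open>auto simp: \<phi>_def \<psi>U C1_grad_def\<close>)
    have DV: "D x = 0" if "x \<in> V" for x
      by (rule C1_grad_unique_local[OF \<phi>1 V(1) that, of "\<lambda>x. 0"])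
        (auto simp: \<phi>_def \<psi>V GDERIV_const)
    have "(\<integral>y. D y \<bullet> (F y - G y) \<partial>lebesgue_on \<Omega>) = 0"
    proof (rule integral_gradient_eq_0_of_vanishing_potential[OF bd _ _ \<phi> _ \<delta>])
      show "\<Omega> \<in> sets lebesgue" using lm\<Omega> by (rule fmeasurableD)
      show "integrable (lebesgue_on \<Omega>) (\<lambda>y. F y - G y)" using iF iG by simp
      show "\<phi> x = 0" if "norm x > R" for x using \<psi>V[OF R[OF that]] by (simp add: \<phi>_def)
      show "D x = D y" if y: "y \<in> \<Omega>" and x: "x \<in> ball y \<delta>" for x y
      proof -
        obtain j where j: "j \<in> {1..N}" "y \<in> \<omega> j" using y union by blast
        have "y \<in> ball y \<delta>" using \<delta> by simp
        then show ?thesis using ballU ballV j x DU DV by (cases "j = i") (metis subsetD)+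
      qed
      fix x assume far: "\<And>y. y \<in> \<Omega> \<Longrightarrow> \<delta> \<le> dist x y"
      have "x \<notin> closure \<Omega>"
        using far \<delta> by (force simp: closure_approachable dist_commute)
      then have "x \<in> exterior \<Omega>" "x \<notin> \<Omega>" using closure_subset by (auto simp: exterior_def)
      then have eq: "(\<integral>y. ((x - y) \<bullet> F y) * reg_power 0 ?p (x - y) \<partial>lebesgue_on \<Omega>)
          = (\<integral>y. ((x - y) \<bullet> G y) * reg_power 0 ?p (x - y) \<partial>lebesgue_on \<Omega>)"
        using assms(10)[of x] unit_sphere_area_pos[where 'a = 'a]
        by (simp add: magnetic_potential_reg_power[OF assms(1)])
      have "?p \<le> 0" by simp
      then show "(\<integral>y. ((x - y) \<bullet> (F y - G y)) * reg_power 0 ?p (x - y) \<partial>lebesgue_on \<Omega>) = 0"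
        using integrable_reg_kernel[OF bd iF _ \<delta> far] integrable_reg_kernel[OF bd iG _ \<delta> far] eq
        by (simp add: inner_diff_right left_diff_distrib Bochner_Integration.integral_diff)
    qed
    also have "(\<integral>y. D y \<bullet> (F y - G y) \<partial>lebesgue_on \<Omega>)
       = (\<integral>y. indicator (\<omega> i) y *\<^sub>R f i y * (a \<bullet> v i) - indicator (\<omega> i) y *\<^sub>R g i y * (a \<bullet> w i) \<partial>lebesgue)"
      unfolding integral_restrict_space[OF sets\<Omega>]
    proof (rule Bochner_Integration.integral_cong[OF refl])
      fix y
      show "indicator \<Omega> y *\<^sub>R (D y \<bullet> (F y - G y))
        = indicator (\<omega> i) y *\<^sub>R f i y * (a \<bullet> v i) - indicator (\<omega> i) y *\<^sub>R g i y * (a \<bullet> w i)"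
      proof (cases "y \<in> \<Omega>")
        case True
        then obtain j where j: "j \<in> {1..N}" "y \<in> \<omega> j" using union by blast
        have yb: "y \<in> ball y \<delta>" using \<delta> by simp
        show ?thesis
        proof (cases "j = i")
          case True
          then have yi: "y \<in> \<omega> i" using j by simp
          then have "D y = a" "y \<in> \<Omega>" using DU ballU[OF yi] yb sub[OF i] by blast+
          then show ?thesis
            using yi val[OF yi i, of f v] val[OF yi i, of g w]
            by (simp add: assms(8,9) inner_diff_right)
        next
          case False
          then have "D y = 0" "y \<notin> \<omega> i" using DV ballV[OF j(2,1)] yb dis[OF j(2,1) i] by blast+
          then show ?thesis by simp
        qed
      next
        case False
        then show ?thesis using sub[OF i] by (auto simp: indicator_def)
      qed
    qed
    also have "\<dots> = (\<integral>y. indicator (\<omega> i) y *\<^sub>R f i y \<partial>lebesgue) * (a \<bullet> v i) - (\<integral>y. indicator (\<omega> i) y *\<^sub>R g i y \<partial>lebesgue) * (a \<bullet> w i)"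
      by (simp only: integral_mult_left_zero Bochner_Integration.integral_diff[OF
            integrable_mult_left[OF int1[OF i assms(6)[OF i]]]
            integrable_mult_left[OF int1[OF i assms(7)[OF i]]]])
    also have "\<dots> = \<alpha> * (a \<bullet> v i) - \<beta> * (a \<bullet> w i)"
      by (simp only: \<alpha>_def \<beta>_def L2_inner_def mult_1_right integral_restrict_space[OF setsL[OF i]])
    finally show ?thesis by (simp add: inner_diff_right)
  qed
  then have "\<alpha> *\<^sub>R v i - \<beta> *\<^sub>R w i = 0" using inner_eq_zero_iff by blast
  then show "(L2_inner (\<omega> i) (f i) (\<lambda>_. 1) = L2_inner (\<omega> i) (g i) (\<lambda>_. 1) \<and>
        (L2_inner (\<omega> i) (f i) (\<lambda>_. 1) = 0 \<or> v i = w i)) \<or>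
      (L2_inner (\<omega> i) (f i) (\<lambda>_. 1) = - L2_inner (\<omega> i) (g i) (\<lambda>_. 1) \<and> v i = - w i)"
    using unit_vector_scaled_eq_cases[OF assms(4)[OF i] assms(5)[OF i], of \<alpha> \<beta>]
    by (simp add: \<alpha>_def \<beta>_def)
qed

end
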